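(* Let $\lambda:\mathbb{N}\to\mathbb{N}$ be any function with $\lambda(n)\to\infty$ as $n\to\infty$, let $\delta:\mathbb{N}\to\mathbb{R}_{\ge 0}$ be any function with $\delta(n)\to 0$ as $n\to\infty$, and let $\gamma>0$. Then there is a function $\eta(n)\to 0$ (depending only on $\lambda,\delta,\gamma$) such that for every $\lambda$-well-behaved feasible degree sequence $\mathcal{D}$ of length $n$ with $R_{\mathcal D}\le \delta(n)M_{\mathcal D}$, the probability that $G(\mathcal D)$ has a component of order at least $\gamma n$ is at most $\eta(n)$; i.e. this probability is $o(1)$.
   Context: A degree sequence $\mathcal D=(d_1,\dots,d_n)$ consists of positive integers (the paper only considers sequences with no zero entries) and is feasible if some simple graph on $\{1,\dots,n\}$ has vertex $i$ of degree $d_i$; $G(\mathcal D)$ denotes a uniformly random simple graph on $\{1,\dots,n\}$ in which vertex $i$ has degree $d_i$. Let $\pi$ be a permutation with $d_{\pi_1}\le\dots\le d_{\pi_n}$. Define $j_{\mathcal D}=\min\big(\{j\in[n]:\sum_{i=1}^j d_{\pi_i}(d_{\pi_i}-2)>0\}\cup\{n\}\big)$, $R_{\mathcal D}=\sum_{i=j_{\mathcal D}}^n d_{\pi_i}$, and $M_{\mathcal D}=\sum_{i\in[n]:d_i\ne 2} d_i$ (these do not depend on the choice of $\pi$). For a function $\lambda:\mathbb N\to\mathbb N$, $\mathcal D$ is $\lambda$-well-behaved if $M_{\mathcal D}\ge\lambda(n)$. The order of a component is its number of vertices. *)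

theory Defs
  imports "HOL-Probability.Probability" "HOL-Combinatorics.Permutations"
begin

(* Simple graphs on {1..n} are represented by their edge sets. *)

definition simple_graphs :: "nat \<Rightarrow> nat set set set" where
  "simple_graphs n = {E. \<forall>e\<in>E. e \<subseteq> {1..n} \<and> card e = 2}"

definition vertex_degree :: "nat set set \<Rightarrow> nat \<Rightarrow> nat" where
  "vertex_degree E v = card {e \<in> E. v \<in> e}"

definition adj_rel :: "nat set set \<Rightarrow> (nat \<times> nat) set" where
  "adj_rel E = {(u, v). {u, v} \<in> E}"

definition component_of :: "nat \<Rightarrow> nat set set \<Rightarrow> nat \<Rightarrow> nat set" where
  "component_of n E v = {w \<in> {1..n}. (v, w) \<in> (adj_rel E)\<^sup>*}"

definition graph_components :: "nat \<Rightarrow> nat set set \<Rightarrow> nat set set" where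
  "graph_components n E = component_of n E ` {1..n}"

(* Sequences (d_1, ..., d_n) are lists; entry gives 1-based access, matching the vertex set {1..n}. *)

definition entry :: "nat list \<Rightarrow> nat \<Rightarrow> nat" where
  "entry D i = D ! (i - 1)"

definition degree_sequence :: "nat list \<Rightarrow> bool" where
  "degree_sequence D \<longleftrightarrow> D \<noteq> [] \<and> (\<forall>i\<in>{1..length D}. entry D i > 0)"

definition realizations :: "nat list \<Rightarrow> nat set set set" where
  "realizations D =
     {E \<in> simple_graphs (length D). \<forall>i\<in>{1..length D}. vertex_degree E i = entry D i}"

definition feasible :: "nat list \<Rightarrow> bool" where
  "feasible D \<longleftrightarrow> realizations D \<noteq> {}"

(* Meaningful for feasible D only: pmf_of_set needs a finite nonempty set
   (finiteness is finite_realizations below). *)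

definition random_graph :: "nat list \<Rightarrow> nat set set pmf" where
  "random_graph D = pmf_of_set (realizations D)"

(* entry (sort D) i is the degree d_(pi_i) for every permutation pi arranging the degrees
   in nondecreasing order; see entry_sort below. *)

definition j_idx :: "nat list \<Rightarrow> nat" where
  "j_idx D = Min ({j \<in> {1..length D}.
       (\<Sum>i=1..j. int (entry (sort D) i) * (int (entry (sort D) i) - 2)) > 0} \<union> {length D})"

definition R_sum :: "nat list \<Rightarrow> nat" where
  "R_sum D = (\<Sum>i=j_idx D..length D. entry (sort D) i)"

definition M_sum :: "nat list \<Rightarrow> nat" where
  "M_sum D = (\<Sum>i\<in>{i \<in> {1..length D}. entry D i \<noteq> 2}. entry D i)"

definition well_behaved :: "(nat \<Rightarrow> nat) \<Rightarrow> nat list \<Rightarrow> bool" where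
  "well_behaved lam D \<longleftrightarrow> M_sum D \<ge> lam (length D)"

lemma finite_realizations: "finite (realizations D)"
proof (rule finite_subset)
  show "realizations D \<subseteq> Pow (Pow {1..length D})"
    by (auto simp: realizations_def simple_graphs_def)
qed simp

lemma entry_sort:
  assumes perm: "\<pi> permutes {1..length D}"
    and mono: "\<And>i j. 1 \<le> i \<Longrightarrow> i \<le> j \<Longrightarrow> j \<le> length D \<Longrightarrow> entry D (\<pi> i) \<le> entry D (\<pi> j)"
    and i: "i \<in> {1..length D}"
  shows "entry (sort D) i = entry D (\<pi> i)"
proof -
  let ?n = "length D"
  let ?xs = "map (\<lambda>i. entry D (\<pi> i)) [1..<Suc ?n]"
  have D: "D = map (entry D) [1..<Suc ?n]"
    by (rule nth_equalityI) (auto simp: entry_def simp del: upt_Suc)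
  have "mset ?xs = image_mset (entry D) (image_mset \<pi> (mset_set {1..?n}))"
    by (simp add: image_mset.compositionality comp_def atLeastLessThanSuc_atLeastAtMost del: upt_Suc)
  also have "image_mset \<pi> (mset_set {1..?n}) = mset_set {1..?n}"
    using perm by (simp add: image_mset_mset_set permutes_inj_on permutes_image)
  also have "image_mset (entry D) (mset_set {1..?n}) = mset (map (entry D) [1..<Suc ?n])"
    by (simp add: atLeastLessThanSuc_atLeastAtMost del: upt_Suc)
  also have "\<dots> = mset D"
    using D by simp
  finally have "mset ?xs = mset D" .
  moreover have "sorted ?xs"
    unfolding sorted_iff_nth_mono using mono by (auto simp del: upt_Suc)
  ultimately have "sort D = ?xs"
    by (rule properties_for_sort)
  moreover have "?xs ! (i - 1) = entry D (\<pi> i)"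
    using i by (auto simp del: upt_Suc)
  ultimately show ?thesis
    by (metis entry_def)
qed

end

theory Submission
  imports Defs
begin

text \<open>
  Let \<open>H\<close> be the vertices from position \<open>j\<^sub>D\<close> on in the degree order, so that the degrees outside
  \<open>H\<close> satisfy \<open>\<Sum> d (d - 2) \<le> 0\<close> while \<open>H\<close> carries total degree \<open>R \<le> \<delta> M\<close>. Enlarge \<open>H\<close> to \<open>S\<close>
  by all vertices of degree at least a large constant \<open>T\<close> and by one arbitrary vertex \<open>v\<close>, and reveal
  the components meeting \<open>S\<close> edge by edge. Conditionally on the edges seen so far, switching
  \<open>uw, lx\<close> with \<open>ul, wx\<close>, where \<open>l\<close> is an unexplored vertex of degree 1, shows that the next edge at
  \<open>u\<close> hits an unexplored \<open>w\<close> at most about \<open>d(w)\<close> times as often as an average unexplored leaf.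

  Let \<open>a\<close> be the number of leaves found and \<open>X\<close> the number of open half-edges. As long as \<open>X > 0\<close>, the
  vertices of degree at least 3 found so far satisfy \<open>\<Sum> (d - 2) \<ge> a - X\<^sub>0\<close>, hence
  \<open>\<Sum> d (d - 2) \<ge> 3 (a - X\<^sub>0)\<close>, so \<open>X\<close> has a drift proportional to \<open>-2a\<close> up to small errors. Therefore \<open>X\<close>
  plus a quadratic function of \<open>a\<close> plus a small multiple of the number of explored vertices is a
  supermartingale, and comparing its initial and final values gives \<open>E |C(v)| \<le> 43 \<theta> n\<close> for every
  \<open>v\<close>, where \<open>C(v)\<close> is the component of \<open>v\<close> and \<open>\<theta>\<close> is arbitrarily small. A component of order
  \<open>\<gamma> n\<close> forces \<open>\<Sum>\<^sub>v |C(v)| \<ge> (\<gamma> n)\<^sup>2\<close>, and Markov's inequality finishes the proof.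
\<close>

section \<open>Neighbourhoods and degrees in simple graphs\<close>

definition nbrs :: "nat set set \<Rightarrow> nat \<Rightarrow> nat set" where
  "nbrs E v = {w. {v, w} \<in> E}"

lemma simple_graphs_subset: "simple_graphs n \<subseteq> Pow (Pow {1..n})"
  by (auto simp: simple_graphs_def)

lemma finite_simple_graph:
  assumes "E \<in> simple_graphs n"
  shows "finite E"
  using assms simple_graphs_subset[of n] by (meson PowD finite_Pow_iff finite_atLeastAtMost finite_subset subsetD)

lemma simple_graph_edge:
  assumes "E \<in> simple_graphs n" "{u, v} \<in> E"
  shows "u \<noteq> v" "u \<in> {1..n}" "v \<in> {1..n}"
  using assms by (auto simp: simple_graphs_def)

lemma simple_graph_pair:
  assumes "E \<in> simple_graphs n" "e \<in> E" "v \<in> e"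
  obtains w where "e = {v, w}" "w \<noteq> v"
proof -
  have "card e = 2" using assms by (auto simp: simple_graphs_def)
  then obtain a b where "e = {a, b}" "a \<noteq> b" by (meson card_2_iff)
  with assms(3) show thesis using that by (metis doubleton_eq_iff insert_iff singletonD)
qed

lemma nbrs_subset: "E \<in> simple_graphs n \<Longrightarrow> nbrs E v \<subseteq> {1..n}"
  unfolding nbrs_def using simple_graph_edge(3) by blast

lemma finite_nbrs: "E \<in> simple_graphs n \<Longrightarrow> finite (nbrs E v)"
  by (rule finite_subset[OF nbrs_subset]) auto

lemma card_nbrs:
  assumes "E \<in> simple_graphs n"
  shows "card (nbrs E v) = vertex_degree E v"
proof -
  have "bij_betw (\<lambda>w. {v, w}) (nbrs E v) {e \<in> E. v \<in> e}"
    unfolding bij_betw_def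
  proof
    show "inj_on (\<lambda>w. {v, w}) (nbrs E v)"
      by (auto simp: inj_on_def doubleton_eq_iff)
    show "(\<lambda>w. {v, w}) ` nbrs E v = {e \<in> E. v \<in> e}"
      using assms by (auto simp: nbrs_def elim!: simple_graph_pair)
  qed
  then show ?thesis
    by (simp add: bij_betw_same_card vertex_degree_def)
qed

lemma vertex_degree_mono:
  assumes "F \<subseteq> E" "finite E"
  shows "vertex_degree F v \<le> vertex_degree E v"
  unfolding vertex_degree_def using assms by (intro card_mono) auto

lemma vertex_degree_insert:
  assumes "finite E" "e \<notin> E"
  shows "vertex_degree (insert e E) v = vertex_degree E v + of_bool (v \<in> e)"
proof -
  have "{f \<in> insert e E. v \<in> f} = (if v \<in> e then insert e {f \<in> E. v \<in> f} else {f \<in> E. v \<in> f})"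
    by auto
  then show ?thesis using assms by (simp add: vertex_degree_def)
qed

lemma vertex_degree_remove:
  assumes "finite E" "e \<in> E"
  shows "vertex_degree E v = vertex_degree (E - {e}) v + of_bool (v \<in> e)"
  using vertex_degree_insert[of "E - {e}" e v] assms by (simp add: insert_absorb)

lemma handshake:
  assumes "E \<in> simple_graphs n" "\<Union>E \<subseteq> A" "finite A"
  shows "(\<Sum>v\<in>A. vertex_degree E v) = 2 * card E"
proof -
  have fin: "finite E" using assms(1) by (rule finite_simple_graph)
  have "(\<Sum>v\<in>A. vertex_degree E v) = (\<Sum>v\<in>A. \<Sum>e\<in>{e\<in>E. v \<in> e}. 1)"
    by (simp add: vertex_degree_def)
  also have "\<dots> = (\<Sum>e\<in>E. \<Sum>v\<in>{v\<in>A. v \<in> e}. 1)"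
    by (rule sum.swap_restrict) (use assms fin in auto)
  also have "\<dots> = (\<Sum>e\<in>E. 2)"
  proof (rule sum.cong[OF refl])
    fix e assume "e \<in> E"
    then have "{v\<in>A. v \<in> e} = e" "card e = 2"
      using assms by (auto simp: simple_graphs_def)
    then show "(\<Sum>v\<in>{v\<in>A. v \<in> e}. 1) = (2::nat)" by simp
  qed
  finally show ?thesis by simp
qed

section \<open>Switchings of two edges\<close>

definition switch :: "nat \<Rightarrow> nat \<Rightarrow> nat \<Rightarrow> nat \<Rightarrow> nat set set \<Rightarrow> nat set set" where
  "switch u w l x E = (E - {{u, w}, {l, x}}) \<union> {{u, l}, {w, x}}"

lemma switch_switch:
  assumes "distinct [u, w, l, x]"
    and "{u, w} \<in> E" "{l, x} \<in> E" "{u, l} \<notin> E" "{w, x} \<notin> E"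
  shows "switch u l w x (switch u w l x E) = E"
  using assms unfolding switch_def by (auto simp: doubleton_eq_iff)

lemma switch_simple_graph:
  assumes "distinct [u, w, l, x]" "{u, w} \<in> E" "{l, x} \<in> E" "E \<in> simple_graphs n"
  shows "switch u w l x E \<in> simple_graphs n"
proof -
  have "u \<in> {1..n}" "w \<in> {1..n}" "l \<in> {1..n}" "x \<in> {1..n}"
    using assms simple_graph_edge by metis+
  then show ?thesis
    using assms unfolding simple_graphs_def switch_def by auto
qed

lemma vertex_degree_switch:
  assumes "distinct [u, w, l, x]"
    and "{u, w} \<in> E" "{l, x} \<in> E" "{u, l} \<notin> E" "{w, x} \<notin> E" "finite E"
  shows "vertex_degree (switch u w l x E) v = vertex_degree E v"
proof -
  let ?E1 = "E - {{u, w}}" let ?E2 = "?E1 - {{l, x}}"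
  have ne: "{l, x} \<noteq> {u, w}" "{u, l} \<noteq> {w, x}" using assms(1) by (auto simp: doubleton_eq_iff)
  have eq: "switch u w l x E = insert {u, l} (insert {w, x} ?E2)"
    unfolding switch_def by blast
  have "vertex_degree (switch u w l x E) v
      = vertex_degree ?E2 v + of_bool (v \<in> {w, x}) + of_bool (v \<in> {u, l})"
    unfolding eq using assms ne by (subst vertex_degree_insert; simp)+
  moreover have "vertex_degree E v = vertex_degree ?E2 v + of_bool (v \<in> {l, x}) + of_bool (v \<in> {u, w})"
    using vertex_degree_remove[of E "{u, w}" v] vertex_degree_remove[of ?E1 "{l, x}" v] assms ne by simp
  moreover have "of_bool (v \<in> {w, x}) + of_bool (v \<in> {u, l}) = (of_bool (v \<in> {l, x}) + of_bool (v \<in> {u, w}) :: nat)"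
    using assms(1) by (cases "v = u"; cases "v = w"; cases "v = l"; cases "v = x"; simp)
  ultimately show ?thesis by simp
qed

section \<open>Counting realizations that extend a revealed edge set\<close>

locale exploration =
  fixes n :: nat and d :: "nat \<Rightarrow> nat" and S :: "nat set" and T :: nat
  assumes S_subset: "S \<subseteq> {1..n}"
    and d_pos: "v \<in> {1..n} \<Longrightarrow> 1 \<le> d v"
    and d_le: "v \<in> {1..n} \<Longrightarrow> v \<notin> S \<Longrightarrow> d v \<le> T"
begin

definition graphs :: "nat set set \<Rightarrow> nat set set set" where
  "graphs F = {E \<in> simple_graphs n. (\<forall>i\<in>{1..n}. vertex_degree E i = d i) \<and> F \<subseteq> E}"

definition explored :: "nat set set \<Rightarrow> nat set" where
  "explored F = S \<union> \<Union>F"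

text \<open>Bounds the number of leaves with which a given edge cannot be switched, see
  \<open>card_leaves_near\<close>.\<close>

definition slack :: nat where
  "slack = sum d S + T * (T + 1)"

lemma graphsD:
  assumes "E \<in> graphs F"
  shows "E \<in> simple_graphs n" "i \<in> {1..n} \<Longrightarrow> vertex_degree E i = d i" "F \<subseteq> E"
  using assms by (auto simp: graphs_def)

lemma finite_S: "finite S"
  using S_subset finite_subset by blast

lemma finite_graphs: "finite (graphs F)"
  by (rule finite_subset[OF _ finite_Pow_iff[THEN iffD2, OF finite_Pow_iff[THEN iffD2, OF finite_atLeastAtMost[of 1 n]]]])
    (auto simp: graphs_def simple_graphs_def)

lemma graphs_insert: "graphs (insert e F) = {E \<in> graphs F. e \<in> E}"
  by (auto simp: graphs_def)

lemma card_nbrs_graphs: "E \<in> graphs F \<Longrightarrow> i \<in> {1..n} \<Longrightarrow> card (nbrs E i) = d i"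
  using card_nbrs[OF graphsD(1)] graphsD(2) by simp

lemma leaf_nbrs:
  assumes "E \<in> graphs F" "l \<in> {1..n}" "d l = 1"
  obtains x where "nbrs E l = {x}"
  using card_nbrs_graphs[OF assms(1,2)] assms(3) that by (metis One_nat_def card_1_singletonE)

text \<open>The pendant edge \<open>{l, x}\<close> serves to switch \<open>{u, w}\<close> away;
  neither removed edge is in \<open>F\<close>, since \<open>F\<close> touches neither
  \<open>w\<close> nor \<open>l\<close>. Graphs already containing \<open>{u, l}\<close> are counted
  on both sides, and those in which \<open>x\<close> is \<open>w\<close> or adjacent to
  \<open>w\<close> form the error term.\<close>

lemma switching_leaf:
  assumes "u \<in> {1..n}" "w \<in> {1..n}" "l \<in> {1..n}" "w \<notin> \<Union>F" "l \<notin> \<Union>F"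
    and ne: "u \<noteq> w" "u \<noteq> l" "w \<noteq> l" and leaf: "d l = 1"
  shows "card (graphs (insert {u, w} F)) \<le> d w * card (graphs (insert {u, l} F))
    + card {E \<in> graphs (insert {u, w} F). \<exists>x. {l, x} \<in> E \<and> (x = w \<or> {x, w} \<in> E)}"
proof -
  let ?near = "\<lambda>E. \<exists>x. {l, x} \<in> E \<and> (x = w \<or> {x, w} \<in> E)"
  let ?P = "{E \<in> graphs F. {u, w} \<in> E \<and> {u, l} \<notin> E \<and> \<not> ?near E}"
  let ?B = "{E \<in> graphs F. {u, w} \<in> E \<and> {u, l} \<in> E}"
  let ?Z = "{E \<in> graphs F. {u, l} \<in> E \<and> {u, w} \<notin> E}"
  define nb where "nb E = the_elem (nbrs E l)" for E
  define f where "f E = (switch u w l (nb E) E, nb E)" for E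
  have P: "distinct [u, w, l, nb E] \<and> {u, w} \<in> E \<and> {l, nb E} \<in> E \<and> {u, l} \<notin> E \<and> {w, nb E} \<notin> E"
    if "E \<in> ?P" for E
  proof -
    from that leaf assms obtain x where x: "nbrs E l = {x}" by (auto elim: leaf_nbrs)
    then have "nb E = x" by (simp add: nb_def)
    moreover have "{l, x} \<in> E" using x by (auto simp: nbrs_def)
    moreover have "x \<noteq> l" using simple_graph_edge[OF graphsD(1)] that \<open>{l, x} \<in> E\<close> by auto
    ultimately show ?thesis using that ne by (auto simp: insert_commute)
  qed
  \<comment> \<open>A switched graph together with the former neighbour \<open>x\<close> of \<open>l\<close> determines the original graph,
    and \<open>x\<close> is one of the \<open>d w\<close> neighbours of \<open>w\<close> after the switch.\<close>
  have "card ?P \<le> card (Sigma ?Z (\<lambda>E. nbrs E w))"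
  proof (rule card_inj_on_le)
    show "inj_on f ?P"
    proof (rule inj_on_inverseI)
      fix E assume "E \<in> ?P"
      from P[OF this] show "(\<lambda>(E', x). switch u l w x E') (f E) = E"
        unfolding f_def by (simp only: case_prod_conv) (rule switch_switch; blast)
    qed
    show "f ` ?P \<subseteq> Sigma ?Z (\<lambda>E. nbrs E w)"
    proof (rule image_subsetI)
      fix E assume E: "E \<in> ?P"
      note p = P[OF E]
      let ?E' = "switch u w l (nb E) E"
      have "?E' \<in> simple_graphs n"
        using p E by (intro switch_simple_graph) (auto dest: graphsD)
      moreover have "vertex_degree ?E' i = d i" if "i \<in> {1..n}" for i
        using p E that finite_simple_graph[of E n]
        by (subst vertex_degree_switch) (auto simp: graphs_def)
      moreover have "F \<subseteq> ?E'"
        using E assms unfolding switch_def graphs_def by auto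
      moreover have "{u, l} \<in> ?E'" "{u, w} \<notin> ?E'" "{w, nb E} \<in> ?E'"
        using p by (auto simp: switch_def doubleton_eq_iff)
      ultimately show "f E \<in> Sigma ?Z (\<lambda>E. nbrs E w)"
        by (auto simp: f_def graphs_def nbrs_def)
    qed
    show "finite (Sigma ?Z (\<lambda>E. nbrs E w))"
      by (rule finite_SigmaI) (auto simp: finite_graphs intro: finite_nbrs dest: graphsD)
  qed
  also have "\<dots> = (\<Sum>E\<in>?Z. card (nbrs E w))"
    by (rule card_SigmaI) (auto simp: finite_graphs intro: finite_nbrs dest: graphsD)
  also have "\<dots> = d w * card ?Z"
  proof -
    have "(\<Sum>E\<in>?Z. card (nbrs E w)) = (\<Sum>E\<in>?Z. d w)"
      by (rule sum.cong) (use assms(2) in \<open>auto simp: card_nbrs_graphs\<close>)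
    then show ?thesis by simp
  qed
  finally have 1: "card ?P \<le> d w * card ?Z" .
  have 2: "card ?B \<le> d w * card ?B" using d_pos[OF assms(2)] by simp
  have 3: "card (graphs (insert {u, l} F)) = card ?Z + card ?B"
    unfolding graphs_insert
    by (subst card_Un_disjoint[symmetric]) (auto simp: finite_graphs intro: arg_cong[where f=card])
  have "graphs (insert {u, w} F) \<subseteq> ?P \<union> (?B \<union> {E \<in> graphs (insert {u, w} F). ?near E})"
    unfolding graphs_insert by auto
  then have "card (graphs (insert {u, w} F))
      \<le> card (?P \<union> (?B \<union> {E \<in> graphs (insert {u, w} F). ?near E}))"
    by (rule card_mono[rotated]) (auto simp: finite_graphs)
  also have "\<dots> \<le> card ?P + (card ?B + card {E \<in> graphs (insert {u, w} F). ?near E})"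
    by (meson card_Un_le add_left_mono order_trans)
  finally show ?thesis using 1 2 unfolding 3 distrib_left by linarith
qed

text \<open>A blocked \<open>l\<close> is a neighbour of some \<open>x\<close> that is
  \<open>w\<close> or adjacent to \<open>w\<close>. Those \<open>x\<close> in \<open>S\<close>
  account for at most \<open>sum d S\<close> vertices; the others number at most
  \<open>T + 1\<close> and have degree at most \<open>T\<close>.\<close>

lemma card_leaves_near:
  assumes "E \<in> graphs F" "w \<in> {1..n}" "w \<notin> S"
  shows "card {l. \<exists>x. {l, x} \<in> E \<and> (x = w \<or> {x, w} \<in> E)} \<le> slack"
proof -
  note E = graphsD(1)[OF assms(1)]
  let ?N = "insert w (nbrs E w) - S"
  have N: "finite ?N" "?N \<subseteq> {1..n} - S"
    using finite_nbrs[OF E] nbrs_subset[OF E] assms by auto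
  have "card (insert w (nbrs E w)) \<le> T + 1"
    using card_nbrs_graphs[OF assms(1,2)] d_le[OF assms(2,3)]
    by (simp add: card_insert_if finite_nbrs[OF E])
  then have cN: "card ?N \<le> T + 1"
    using card_mono[of "insert w (nbrs E w)" ?N] finite_nbrs[OF E] by auto
  have "{l. \<exists>x. {l, x} \<in> E \<and> (x = w \<or> {x, w} \<in> E)} \<subseteq> (\<Union>x\<in>S. nbrs E x) \<union> (\<Union>x\<in>?N. nbrs E x)"
    by (auto simp: nbrs_def insert_commute)
  then have "card {l. \<exists>x. {l, x} \<in> E \<and> (x = w \<or> {x, w} \<in> E)}
      \<le> card ((\<Union>x\<in>S. nbrs E x) \<union> (\<Union>x\<in>?N. nbrs E x))"
    by (rule card_mono[rotated]) (use finite_S N finite_nbrs[OF E] in auto)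
  also have "\<dots> \<le> card (\<Union>x\<in>S. nbrs E x) + card (\<Union>x\<in>?N. nbrs E x)"
    by (rule card_Un_le)
  also have "card (\<Union>x\<in>S. nbrs E x) \<le> (\<Sum>x\<in>S. card (nbrs E x))"
    by (rule card_UN_le[OF finite_S])
  also have "\<dots> = sum d S"
    using S_subset by (intro sum.cong refl card_nbrs_graphs[OF assms(1)]) auto
  also have "card (\<Union>x\<in>?N. nbrs E x) \<le> (\<Sum>x\<in>?N. card (nbrs E x))"
    by (rule card_UN_le[OF N(1)])
  also have "\<dots> \<le> (\<Sum>x\<in>?N. T)"
    using N(2) by (intro sum_mono) (metis DiffD1 DiffD2 assms(1) card_nbrs_graphs d_le subsetD)
  also have "\<dots> \<le> T * (T + 1)" using mult_right_mono[OF cN, of T] by (simp add: mult.commute)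
  finally show ?thesis by (simp add: slack_def)
qed

text \<open>Sums \<open>switching_leaf\<close> over all unexplored leaves and double counts the
  blocked pairs \<open>(l, E)\<close>. For \<open>l = w\<close> the bound only needs
  \<open>1 \<le> d w\<close>.\<close>

lemma switching_average:
  fixes F u
  defines "c \<equiv> \<lambda>w. card (graphs (insert {u, w} F))"
    and "\<Lambda> \<equiv> {l \<in> {1..n} - explored F. d l = 1}"
  assumes "u \<in> {1..n}" "u \<in> explored F" "w \<in> {1..n}" "w \<notin> explored F"
  shows "card \<Lambda> * c w \<le> d w * (\<Sum>l\<in>\<Lambda>. c l) + slack * c w"
proof -
  let ?near = "\<lambda>l E. \<exists>x. {l, x} \<in> E \<and> (x = w \<or> {x, w} \<in> E)"
  let ?W = "graphs (insert {u, w} F)"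
  have fin: "finite \<Lambda>" by (simp add: \<Lambda>_def)
  have "c w \<le> d w * c l + card {E \<in> ?W. ?near l E}" if "l \<in> \<Lambda>" for l
  proof (cases "l = w")
    case True
    then show ?thesis using d_pos[OF assms(5)] by (simp add: trans_le_add1)
  next
    case False
    then show ?thesis unfolding c_def
      using that assms by (intro switching_leaf) (auto simp: \<Lambda>_def explored_def)
  qed
  then have "(\<Sum>l\<in>\<Lambda>. c w) \<le> (\<Sum>l\<in>\<Lambda>. d w * c l + card {E \<in> ?W. ?near l E})"
    by (rule sum_mono)
  also have "\<dots> = d w * (\<Sum>l\<in>\<Lambda>. c l) + (\<Sum>l\<in>\<Lambda>. \<Sum>E\<in>{E \<in> ?W. ?near l E}. 1)"
    by (simp add: sum.distrib sum_distrib_left)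
  also have "(\<Sum>l\<in>\<Lambda>. \<Sum>E\<in>{E \<in> ?W. ?near l E}. 1) = (\<Sum>E\<in>?W. \<Sum>l\<in>{l \<in> \<Lambda>. ?near l E}. (1::nat))"
    by (rule sum.swap_restrict[OF fin finite_graphs])
  also have "\<dots> \<le> (\<Sum>E\<in>?W. slack)"
  proof (rule sum_mono)
    fix E assume E: "E \<in> ?W"
    have sub: "{l. ?near l E} \<subseteq> {1..n}"
      using simple_graph_edge[OF graphsD(1)[OF E]] by blast
    have "card {l \<in> \<Lambda>. ?near l E} \<le> card {l. ?near l E}"
      by (rule card_mono) (use finite_subset[OF sub] in auto)
    also have "\<dots> \<le> slack"
      using card_leaves_near[OF E] assms by (auto simp: explored_def)
    finally show "(\<Sum>l\<in>{l \<in> \<Lambda>. ?near l E}. 1) \<le> slack" by simp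
  qed
  also have "\<dots> = slack * c w" by (simp add: c_def)
  finally show ?thesis by simp
qed

section \<open>Open half-edges and conditioning on the next edge\<close>

definition leaves :: "nat set" where
  "leaves = {v \<in> {1..n} - S. d v = 1}"

definition reach :: "nat set set \<Rightarrow> nat set" where
  "reach E = (\<Union>s\<in>S. component_of n E s)"

lemma explored_subset:
  assumes "F \<in> simple_graphs n"
  shows "explored F \<subseteq> {1..n}"
  using assms S_subset by (auto simp: explored_def simple_graphs_def)

text \<open>The difference of the two sides counts the open half-edges: it is the sum of
  \<open>d v - vertex_degree F v\<close> over the explored vertices, with no negative term.\<close>

lemma sum_explored_ge:
  assumes "E \<in> graphs F"
  shows "2 * card F \<le> sum d (explored F)"
    and "u \<in> explored F \<Longrightarrow> vertex_degree F u < d u \<Longrightarrow> 2 * card F < sum d (explored F)"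
proof -
  have F: "F \<in> simple_graphs n" using assms by (auto simp: graphs_def simple_graphs_def)
  have fin: "finite (explored F)" using explored_subset[OF F] finite_subset by blast
  have le: "vertex_degree F v \<le> d v" if "v \<in> explored F" for v
    using that explored_subset[OF F] graphsD[OF assms] finite_simple_graph vertex_degree_mono
    by (metis subsetD)
  have sum: "(\<Sum>v\<in>explored F. vertex_degree F v) = 2 * card F"
    by (rule handshake[OF F _ fin]) (auto simp: explored_def)
  show "2 * card F \<le> sum d (explored F)"
    unfolding sum[symmetric] by (rule sum_mono) (rule le)
  show "2 * card F < sum d (explored F)" if "u \<in> explored F" "vertex_degree F u < d u"
    unfolding sum[symmetric] by (rule sum_strict_mono_ex1[OF fin]) (use le that in auto)
qed

text \<open>Once no half-edge is open, every edge of \<open>E\<close> at an explored vertex already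
  lies in \<open>F\<close>, so the explored set, which contains \<open>S\<close>, is closed under
  adjacency in \<open>E\<close>.\<close>

lemma reach_subset_explored:
  assumes E: "E \<in> graphs F" and full: "\<And>u. u \<in> explored F \<Longrightarrow> d u \<le> vertex_degree F u"
  shows "reach E \<subseteq> explored F"
proof -
  have F: "F \<in> simple_graphs n" using E by (auto simp: graphs_def simple_graphs_def)
  have closed: "w \<in> explored F" if "u \<in> explored F" "{u, w} \<in> E" for u w
  proof -
    note fin = finite_simple_graph[OF graphsD(1)[OF E]]
    have "u \<in> {1..n}" using that explored_subset[OF F] by auto
    then have "card {e \<in> E. u \<in> e} \<le> card {e \<in> F. u \<in> e}"
      using full[OF that(1)] graphsD(2)[OF E] by (simp add: vertex_degree_def)
    then have "{e \<in> F. u \<in> e} = {e \<in> E. u \<in> e}"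
      using graphsD(3)[OF E] fin by (intro card_seteq) auto
    then have "{u, w} \<in> F" using that by auto
    then show ?thesis by (auto simp: explored_def)
  qed
  have "w \<in> explored F" if "(s, w) \<in> (adj_rel E)\<^sup>*" "s \<in> S" for s w
    using that
  proof (induction rule: rtrancl_induct)
    case base
    then show ?case by (simp add: explored_def)
  next
    case (step y z)
    then show ?case using closed[of y z] by (simp add: adj_rel_def)
  qed
  then show ?thesis by (auto simp: reach_def component_of_def)
qed

text \<open>Conditioning on a uniformly random unrevealed edge at \<open>u\<close>.\<close>

lemma sum_next_neighbour:
  fixes f :: "nat set set \<Rightarrow> real"
  assumes F: "F \<in> simple_graphs n" and u: "u \<in> {1..n}"
  defines "N \<equiv> {w \<in> {1..n}. {u, w} \<notin> F}"
  shows "real (d u - vertex_degree F u) * (\<Sum>E\<in>graphs F. f E)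
    = (\<Sum>w\<in>N. \<Sum>E\<in>graphs (insert {u, w} F). f E)"
proof -
  have "card {w \<in> N. {u, w} \<in> E} = d u - vertex_degree F u" if E: "E \<in> graphs F" for E
  proof -
    have "{w \<in> N. {u, w} \<in> E} = nbrs E u - nbrs F u"
      using simple_graph_edge[OF graphsD(1)[OF E]] by (auto simp: N_def nbrs_def)
    moreover have "nbrs F u \<subseteq> nbrs E u" using graphsD(3)[OF E] by (auto simp: nbrs_def)
    ultimately show ?thesis
      using card_Diff_subset[OF finite_nbrs[OF F]] card_nbrs[OF F] card_nbrs_graphs[OF E u] by simp
  qed
  then have "real (d u - vertex_degree F u) * (\<Sum>E\<in>graphs F. f E)
      = (\<Sum>E\<in>graphs F. \<Sum>w\<in>{w \<in> N. {u, w} \<in> E}. f E)"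
    by (simp add: sum_distrib_left)
  also have "\<dots> = (\<Sum>w\<in>N. \<Sum>E\<in>{E \<in> graphs F. {u, w} \<in> E}. f E)"
    by (rule sum.swap_restrict) (auto simp: finite_graphs N_def)
  finally show ?thesis by (simp add: graphs_insert)
qed

end

section \<open>The supermartingale of the exploration\<close>

text \<open>The \<open>+ 1\<close> in \<open>excess\<close> makes room for the arbitrary vertex put
  into \<open>S\<close>, which may be a leaf and is then missing from \<open>leaves\<close>.
  \<open>\<beta>\<close> is the weight of an explored vertex in \<open>potential\<close>.\<close>

locale subcritical_exploration = exploration +
  fixes W \<beta> :: real
  assumes excess: "(\<Sum>v\<in>{v \<in> {1..n} - S. 3 \<le> d v}. d v * (d v - 2)) \<le> card leaves + 1"
    and total: "real (\<Sum>v\<in>{1..n} - S. d v) \<le> W"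
    and small: "3 * (sum d S + slack) \<le> card leaves"
    and leaves_ne: "1 \<le> card leaves"
    and beta: "0 \<le> \<beta>"
begin

text \<open>Collects the errors of the drift estimate: \<open>slack\<close> for blocked switchings,
  \<open>3 * sum d S\<close> for the half-edges open at the start, \<open>\<beta> * W\<close> for
  counting explored vertices.\<close>

definition B :: real where
  "B = slack + 3 * sum d S + \<beta> * W"

text \<open>Chosen so that one further leaf changes \<open>h\<close> by \<open>(2 a - 3 B) / n\<^sub>1\<close>. As the number of unexplored
  leaves (minus \<open>slack\<close>) stays between \<open>n\<^sub>1 / 3\<close> and \<open>n\<^sub>1\<close>, this compensates a drift proportional to
  \<open>B - 2 a\<close> whatever its sign.\<close>

definition h :: "nat \<Rightarrow> real" where
  "h a = (real a * (real a - 1) - 3 * B * real a) / card leaves"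

definition found :: "nat set set \<Rightarrow> nat" where
  "found F = card (explored F \<inter> leaves)"

text \<open>The change of \<open>potential\<close> when an edge leads to a new vertex
  \<open>w\<close>; the \<open>- 2\<close> is there because the edge closes one half-edge at each
  end.\<close>

definition gain :: "nat set set \<Rightarrow> nat \<Rightarrow> real" where
  "gain F w = real (d w) - 2 + \<beta> + of_bool (d w = 1) * (h (found F + 1) - h (found F))"

text \<open>The first two terms count the open half-edges at explored vertices.\<close>

definition potential :: "nat set set \<Rightarrow> real" where
  "potential F = real (sum d (explored F)) - 2 * real (card F)
     + \<beta> * real (card (explored F - S)) + h (found F)"

text \<open>Up to the factor \<open>s / m\<close>, leaves contribute \<open>- m\<close> and vertices
  of degree at least 3 at most the excess not yet found, which has dropped by \<open>q\<close>. As
  \<open>q\<close> grows like \<open>3 * a\<close> while \<open>m\<close> falls only like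
  \<open>a\<close>, the drift without \<open>h\<close> is at most \<open>B - 2 * a\<close>, and
  \<open>h\<close> compensates this.\<close>

lemma drift_nonpos:
  assumes F: "F \<in> simple_graphs n" and E: "E \<in> graphs F"
    and tree: "card (explored F - S) \<le> card F"
    and u: "u \<in> explored F" "vertex_degree F u < d u"
  shows "(\<Sum>w\<in>{1..n} - explored F. real (card (graphs (insert {u, w} F))) * gain F w) \<le> 0"
proof -
  define A where "A = explored F"
  define U where "U = {1..n} - A"
  define c where "c w = real (card (graphs (insert {u, w} F)))" for w
  define lf :: "nat \<Rightarrow> real" where "lf w = of_bool (d w = 1)" for w
  define g :: "nat \<Rightarrow> real" where "g w = of_bool (3 \<le> d w) * (real (d w) * (real (d w) - 2))" for w
  define s where "s = (\<Sum>l\<in>U. lf l * c l)"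
  define a where "a = real (found F)"
  define q where "q = (\<Sum>v\<in>A - S. g v)"
  define n1 where "n1 = real (card leaves)"
  define m where "m = n1 - a - real slack"
  define Dh where "Dh = h (found F + 1) - h (found F)"
  have AV: "A \<subseteq> {1..n}" and SA: "S \<subseteq> A"
    using explored_subset[OF F] by (auto simp: A_def explored_def)
  have fA: "finite A" using AV finite_subset by blast
  have split: "{1..n} - S = (A - S) \<union> U" "(A - S) \<inter> U = {}"
    using AV SA by (auto simp: U_def)
  have d1: "1 \<le> d v" if "v \<in> {1..n}" for v using d_pos that by simp
  have n1: "1 \<le> n1" using leaves_ne by (simp add: n1_def)
  have lfA: "(\<Sum>v\<in>A - S. lf v) = a"
  proof -
    have "(\<Sum>v\<in>A - S. lf v) = real (card ((A - S) \<inter> {v. d v = 1}))"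
      using fA by (simp add: lf_def)
    also have "(A - S) \<inter> {v. d v = 1} = A \<inter> leaves" using AV by (auto simp: leaves_def)
    finally show ?thesis by (simp add: a_def found_def A_def)
  qed
  have lfU: "(\<Sum>v\<in>U. lf v) = n1 - a"
  proof -
    have "(\<Sum>v\<in>{1..n} - S. lf v) = real (card (({1..n} - S) \<inter> {v. d v = 1}))"
      by (simp add: lf_def)
    also have "({1..n} - S) \<inter> {v. d v = 1} = leaves" by (auto simp: leaves_def)
    finally have "(\<Sum>v\<in>(A - S) \<union> U. lf v) = n1" by (simp only: n1_def split)
    moreover have "(\<Sum>v\<in>(A - S) \<union> U. lf v) = (\<Sum>v\<in>A - S. lf v) + (\<Sum>v\<in>U. lf v)"
      by (rule sum.union_disjoint) (use fA split in \<open>auto simp: U_def\<close>)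
    ultimately show ?thesis using lfA by simp
  qed
  have gU: "(\<Sum>v\<in>U. g v) \<le> n1 + 1 - q"
  proof -
    have "(\<Sum>v\<in>{1..n} - S. g v) = (\<Sum>v\<in>{v \<in> {1..n} - S. 3 \<le> d v}. g v)"
      by (rule sum.mono_neutral_right) (auto simp: g_def)
    also have "\<dots> = (\<Sum>v\<in>{v \<in> {1..n} - S. 3 \<le> d v}. real (d v * (d v - 2)))"
      by (rule sum.cong) (auto simp: g_def of_nat_diff)
    also have "\<dots> = real (\<Sum>v\<in>{v \<in> {1..n} - S. 3 \<le> d v}. d v * (d v - 2))"
      by simp
    also have "\<dots> \<le> n1 + 1"
      using of_nat_mono[OF excess, where ?'a = real] by (simp add: n1_def)
    finally have "(\<Sum>v\<in>(A - S) \<union> U. g v) \<le> n1 + 1" by (simp only: split)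
    moreover have "(\<Sum>v\<in>(A - S) \<union> U. g v) = q + (\<Sum>v\<in>U. g v)"
      unfolding q_def by (rule sum.union_disjoint) (use fA split in \<open>auto simp: U_def\<close>)
    ultimately show ?thesis by simp
  qed
  have g0: "0 \<le> g v" for v by (simp add: g_def)
  \<comment> \<open>The open half-edge at \<open>u\<close> forces the sum of \<open>d v - 2\<close>
    over \<open>A - S\<close> to be at least \<open>1 - sum d S\<close>. Multiplying by 3 and using
    \<open>3 \<le> d v\<close> for the positive terms bounds \<open>q\<close>, each leaf costing
    3.\<close>
  have q: "3 * a + 3 - 3 * real (sum d S) \<le> q"
  proof -
    have "2 * card F < sum d A" using sum_explored_ge(2)[OF E u] by (simp add: A_def)
    also have "sum d A = sum d S + sum d (A - S)"
      using SA fA by (metis sum.subset_diff add.commute)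
    finally have "2 * card (A - S) + 1 \<le> sum d S + sum d (A - S)"
      using tree by (simp add: A_def)
    then have "2 * real (card (A - S)) + 1 \<le> real (sum d S) + real (sum d (A - S))"
      by linarith
    then have "1 - real (sum d S) \<le> (\<Sum>v\<in>A - S. real (d v) - 2)"
      by (simp add: sum_subtractf)
    moreover have "3 * (\<Sum>v\<in>A - S. real (d v) - 2) \<le> (\<Sum>v\<in>A - S. g v - 3 * lf v)"
      unfolding sum_distrib_left
    proof (rule sum_mono)
      fix v assume "v \<in> A - S"
      then have "1 \<le> d v" using AV d1 by auto
      then consider "d v = 1" | "d v = 2" | "3 \<le> d v" by linarith
      then show "3 * (real (d v) - 2) \<le> g v - 3 * lf v"
      proof cases
        case 3
        then have "3 * (real (d v) - 2) \<le> real (d v) * (real (d v) - 2)"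
          by (intro mult_right_mono) auto
        then show ?thesis using 3 by (simp add: g_def lf_def)
      qed (auto simp: g_def lf_def)
    qed
    moreover have "(\<Sum>v\<in>A - S. g v - 3 * lf v) = q - 3 * a"
      by (simp add: sum_subtractf q_def lfA flip: sum_distrib_left)
    ultimately show ?thesis by linarith
  qed
  \<comment> \<open>The unexplored excess cannot be negative, which limits the leaves found while
    the exploration is alive and keeps \<open>m\<close> at least a third of
    \<open>n1\<close>.\<close>
  have "0 \<le> (\<Sum>v\<in>U. g v)" by (simp add: g0 sum_nonneg)
  then have a_le: "3 * a + 2 \<le> n1 + 3 * real (sum d S)" using gU q by linarith
  have "3 * (real (sum d S) + real slack) \<le> n1"
    using of_nat_mono[OF small, where ?'a = real] by (simp add: n1_def)
  then have m: "n1 \<le> 3 * m" "m \<le> n1"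
    using a_le by (auto simp: m_def a_def)
  then have m0: "0 < m" using n1 by linarith
  have c0: "0 \<le> c w" "0 \<le> lf w" for w by (simp_all add: c_def lf_def)
  have s0: "0 \<le> s" unfolding s_def by (intro sum_nonneg mult_nonneg_nonneg c0)
  have avg: "m * c w \<le> real (d w) * s" if "w \<in> U" for w
  proof -
    define \<Lambda> where "\<Lambda> = {l \<in> {1..n} - explored F. d l = 1}"
    have "card \<Lambda> * card (graphs (insert {u, w} F))
        \<le> d w * (\<Sum>l\<in>\<Lambda>. card (graphs (insert {u, l} F))) + slack * card (graphs (insert {u, w} F))"
      unfolding \<Lambda>_def using that u AV by (intro switching_average) (auto simp: U_def A_def)
    from of_nat_mono[OF this, where ?'a = real]
    have "real (card \<Lambda>) * c w \<le> real (d w) * (\<Sum>l\<in>\<Lambda>. c l) + real slack * c w"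
      by (simp add: c_def)
    moreover have "real (card \<Lambda>) = n1 - a"
    proof -
      have "U \<inter> {v. d v = 1} = \<Lambda>" by (auto simp: \<Lambda>_def U_def A_def)
      then show ?thesis using lfU by (simp add: lf_def U_def)
    qed
    moreover have "(\<Sum>l\<in>\<Lambda>. c l) = s"
    proof -
      have "s = (\<Sum>l\<in>\<Lambda>. lf l * c l)"
        unfolding s_def by (rule sum.mono_neutral_right) (auto simp: \<Lambda>_def U_def A_def lf_def)
      also have "\<dots> = (\<Sum>l\<in>\<Lambda>. c l)" by (rule sum.cong) (auto simp: \<Lambda>_def lf_def)
      finally show ?thesis by simp
    qed
    ultimately show ?thesis by (simp add: m_def algebra_simps)
  qed
  have sumU: "(\<Sum>w\<in>U. real (d w)) \<le> W"
  proof -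
    have "(\<Sum>w\<in>U. real (d w)) \<le> (\<Sum>w\<in>{1..n} - S. real (d w))"
      by (rule sum_mono2) (auto simp: U_def A_def explored_def)
    then show ?thesis using total by simp
  qed
  have Dh: "Dh = (2 * a - 3 * B) / n1"
    using n1 by (simp add: Dh_def h_def a_def n1_def field_simps)
  have "m * (\<Sum>w\<in>U. c w * gain F w) = (\<Sum>w\<in>U. m * (c w * gain F w))"
    by (rule sum_distrib_left)
  \<comment> \<open>\<open>avg\<close> is applied only with nonnegative coefficients, that is to
    degrees at least 3 and to the \<open>\<beta>\<close> terms. The other leaf terms have a negative
    coefficient or one of unknown sign; they are kept exactly and sum to multiples of
    \<open>s\<close>.\<close>
  also have "\<dots> \<le> (\<Sum>w\<in>U. s * g w - m * (lf w * c w) + \<beta> * s * real (d w) + m * Dh * (lf w * c w))"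
  proof (rule sum_mono)
    fix w assume w: "w \<in> U"
    then have "1 \<le> d w" using d1 by (auto simp: U_def)
    then consider "d w = 1" | "d w = 2" | "3 \<le> d w" by linarith
    then have "m * c w * (real (d w) - 2) \<le> s * g w - m * (lf w * c w)"
    proof cases
      case 3
      then have "m * c w * (real (d w) - 2) \<le> real (d w) * s * (real (d w) - 2)"
        using avg[OF w] by (intro mult_right_mono) auto
      then show ?thesis using 3 by (simp add: g_def lf_def algebra_simps)
    qed (auto simp: g_def lf_def)
    moreover have "\<beta> * (m * c w) \<le> \<beta> * (real (d w) * s)"
      using avg[OF w] beta by (rule mult_left_mono)
    moreover have "m * (c w * gain F w)
        = m * c w * (real (d w) - 2) + \<beta> * (m * c w) + m * Dh * (lf w * c w)"
      by (simp add: gain_def Dh_def lf_def algebra_simps)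
    ultimately show "m * (c w * gain F w)
        \<le> s * g w - m * (lf w * c w) + \<beta> * s * real (d w) + m * Dh * (lf w * c w)"
      by (simp add: algebra_simps)
  qed
  also have "\<dots> = s * (\<Sum>w\<in>U. g w) - m * s + \<beta> * s * (\<Sum>w\<in>U. real (d w)) + m * Dh * s"
    by (simp add: sum.distrib sum_subtractf s_def flip: sum_distrib_left)
  also have "\<dots> = s * ((\<Sum>w\<in>U. g w) - m + \<beta> * (\<Sum>w\<in>U. real (d w)) + m * Dh)"
    by (simp add: algebra_simps)
  also have "\<dots> \<le> 0"
  proof (rule mult_nonneg_nonpos[OF s0])
    have "\<beta> * (\<Sum>w\<in>U. real (d w)) \<le> \<beta> * W"
      using sumU beta by (rule mult_left_mono)
    then have 1: "(\<Sum>w\<in>U. g w) - m + \<beta> * (\<Sum>w\<in>U. real (d w)) \<le> B - 2 * a"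
      using gU q by (simp add: m_def B_def)
    have "0 \<le> (\<Sum>w\<in>U. real (d w))" by (simp add: sum_nonneg)
    then have "0 \<le> \<beta> * W" using sumU beta by (intro mult_nonneg_nonneg) linarith+
    then have B0: "0 \<le> B" by (simp add: B_def sum_nonneg)
    \<comment> \<open>For \<open>B \<le> 2 * a\<close> the bound \<open>m \<le> n1\<close> suffices;
      otherwise \<open>2 * a - 3 * B \<le> 3 * (2 * a - B)\<close> brings in
      \<open>n1 \<le> 3 * m\<close>.\<close>
    have "m * (2 * a - 3 * B) \<le> n1 * (2 * a - B)"
    proof (cases "B \<le> 2 * a")
      case True
      have "m * (2 * a - 3 * B) \<le> m * (2 * a - B)" using m0 B0 by simp
      also have "\<dots> \<le> n1 * (2 * a - B)" using m True by (intro mult_right_mono) auto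
      finally show ?thesis .
    next
      case False
      have "m * (2 * a - 3 * B) \<le> m * (3 * (2 * a - B))"
        using m0 by (intro mult_left_mono) (auto simp: a_def)
      also have "\<dots> = (3 * m) * (2 * a - B)" by simp
      also have "\<dots> \<le> n1 * (2 * a - B)" using m False by (intro mult_right_mono_neg) auto
      finally show ?thesis .
    qed
    then have 2: "m * Dh \<le> 2 * a - B"
      using n1 by (simp add: Dh field_simps)
    show "(\<Sum>w\<in>U. g w) - m + \<beta> * (\<Sum>w\<in>U. real (d w)) + m * Dh \<le> 0"
      using 1 2 by linarith
  qed
  finally have "(\<Sum>w\<in>U. c w * gain F w) \<le> 0"
    using m0 by (simp add: mult_le_0_iff)
  then show ?thesis by (simp add: U_def A_def c_def)
qed

text \<open>An edge back into the explored set only closes two half-edges and so lowers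
  \<open>potential\<close>.\<close>

lemma potential_insert:
  assumes F: "F \<in> simple_graphs n" and u: "u \<in> explored F" and w: "w \<in> {1..n}" "{u, w} \<notin> F"
  shows "potential (insert {u, w} F) \<le> potential F + (if w \<in> explored F then 0 else gain F w)"
proof -
  have card: "card (insert {u, w} F) = card F + 1"
    using finite_simple_graph[OF F] w by simp
  have fin: "finite (explored F)" using explored_subset[OF F] finite_subset by blast
  have ex: "explored (insert {u, w} F) = insert w (explored F)"
    using u by (auto simp: explored_def)
  show ?thesis
  proof (cases "w \<in> explored F")
    case True
    then show ?thesis by (simp add: potential_def found_def ex card insert_absorb)
  next
    case False
    have "w \<notin> S" using False by (auto simp: explored_def)
    then have 1: "card (insert w (explored F) - S) = card (explored F - S) + 1"
      using False fin by (simp add: insert_Diff_if)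
    have "insert w (explored F) \<inter> leaves
        = (if d w = 1 then insert w (explored F \<inter> leaves) else explored F \<inter> leaves)"
      using w \<open>w \<notin> S\<close> by (auto simp: leaves_def)
    then have 2: "found (insert {u, w} F) = found F + of_bool (d w = 1)"
      using False fin by (simp add: found_def ex)
    show ?thesis
      using False fin by (simp add: potential_def gain_def 2 ex card 1 algebra_simps)
  qed
qed

text \<open>Optional stopping in counting form. The induction conditions on the next edge at a
  vertex with an open half-edge, where \<open>drift_nonpos\<close> keeps the average potential from
  growing. When no half-edge is open, \<open>potential F + C\<close> is at least
  \<open>\<beta>\<close> times the number of explored vertices outside \<open>S\<close>.\<close>

lemma reach_bound:
  assumes C: "\<And>a. - C \<le> h a"
    and "F \<in> simple_graphs n" "card (explored F - S) \<le> card F"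
  shows "(\<Sum>E\<in>graphs F. \<beta> * real (card (reach E - S))) \<le> real (card (graphs F)) * (potential F + C)"
  using assms(2,3)
proof (induction "card (Pow {1..n} - F)" arbitrary: F rule: less_induct)
  case less
  note F = less.prems(1) and tree = less.prems(2)
  consider "graphs F = {}"
    | (saturated) E where "E \<in> graphs F" "\<And>u. u \<in> explored F \<Longrightarrow> d u \<le> vertex_degree F u"
    | (alive) E u where "E \<in> graphs F" "u \<in> explored F" "vertex_degree F u < d u"
    by (metis all_not_in_conv not_le)
  then show ?case
  proof cases
    case 1
    then show ?thesis by simp
  next
    case saturated
    have fin: "finite (explored F - S)" using explored_subset[OF F] finite_subset by blast
    have "2 * real (card F) \<le> real (sum d (explored F))"
      using of_nat_mono[OF sum_explored_ge(1)[OF saturated(1)], where ?'a = real] by simp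
    then have pot: "\<beta> * real (card (explored F - S)) \<le> potential F + C"
      using C[of "found F"] by (simp add: potential_def)
    have "(\<Sum>E\<in>graphs F. \<beta> * real (card (reach E - S))) \<le> (\<Sum>E\<in>graphs F. potential F + C)"
    proof (rule sum_mono)
      fix E assume "E \<in> graphs F"
      then have "card (reach E - S) \<le> card (explored F - S)"
        using reach_subset_explored saturated(2) by (intro card_mono[OF fin]) blast
      then have "\<beta> * real (card (reach E - S)) \<le> \<beta> * real (card (explored F - S))"
        using beta by (intro mult_left_mono) auto
      then show "\<beta> * real (card (reach E - S)) \<le> potential F + C" using pot by linarith
    qed
    then show ?thesis by simp
  next
    case alive
    define N where "N = {w \<in> {1..n}. {u, w} \<notin> F}"
    define r where "r = real (d u - vertex_degree F u)"
    define c where "c w = real (card (graphs (insert {u, w} F)))" for w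
    let ?f = "\<lambda>E. \<beta> * real (card (reach E - S))"
    have uV: "u \<in> {1..n}" using alive explored_subset[OF F] by auto
    have r: "0 < r" using alive by (simp add: r_def)
    have IH: "(\<Sum>E\<in>graphs (insert {u, w} F). ?f E) \<le> c w * (potential (insert {u, w} F) + C)"
      if w: "w \<in> N" for w
    \<comment> \<open>\<open>N\<close> contains \<open>u\<close> itself, but no graph extends a
      loop; any extension shows that the enlarged edge set is simple.\<close>
    proof (cases "graphs (insert {u, w} F) = {}")
      case True
      then show ?thesis by (simp add: c_def)
    next
      case False
      then obtain E' where E': "E' \<in> graphs (insert {u, w} F)" by blast
      have sg: "insert {u, w} F \<in> simple_graphs n"
        using E' by (auto simp: graphs_def simple_graphs_def)
      have new: "{u, w} \<in> Pow {1..n} - F" using w uV by (simp add: N_def)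
      have "card (Pow {1..n} - insert {u, w} F) < card (Pow {1..n} - F)"
        unfolding Diff_insert[of "Pow {1..n}"] by (rule card_Diff1_less[OF _ new]) simp
      moreover have "card (explored (insert {u, w} F) - S) \<le> card (insert {u, w} F)"
      proof -
        have fin: "finite (explored F - S)" using explored_subset[OF F] finite_subset by blast
        have "explored (insert {u, w} F) - S \<subseteq> insert w (explored F - S)"
          using alive by (auto simp: explored_def)
        then have "card (explored (insert {u, w} F) - S) \<le> card (insert w (explored F - S))"
          by (rule card_mono[rotated]) (use fin in simp)
        also have "\<dots> \<le> card (explored F - S) + 1" by (simp add: card_insert_if fin)
        also have "\<dots> \<le> card F + 1" using tree by simp
        also have "\<dots> = card (insert {u, w} F)"
          using w finite_simple_graph[OF F] by (simp add: N_def)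
        finally show ?thesis .
      qed
      ultimately show ?thesis unfolding c_def using less.hyps sg by blast
    qed
    have "r * (\<Sum>E\<in>graphs F. ?f E) = (\<Sum>w\<in>N. \<Sum>E\<in>graphs (insert {u, w} F). ?f E)"
      unfolding r_def N_def by (rule sum_next_neighbour[OF F uV])
    also have "\<dots> \<le> (\<Sum>w\<in>N. c w * (potential (insert {u, w} F) + C))"
      by (rule sum_mono) (rule IH)
    also have "\<dots> \<le> (\<Sum>w\<in>N. c w * (potential F + C) + (if w \<in> explored F then 0 else c w * gain F w))"
    proof (rule sum_mono)
      fix w assume "w \<in> N"
      then have "potential (insert {u, w} F) \<le> potential F + (if w \<in> explored F then 0 else gain F w)"
        using potential_insert[OF F alive(2)] by (auto simp: N_def)
      then have "c w * (potential (insert {u, w} F) + C)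
          \<le> c w * (potential F + (if w \<in> explored F then 0 else gain F w) + C)"
        by (intro mult_left_mono) (auto simp: c_def)
      then show "c w * (potential (insert {u, w} F) + C)
          \<le> c w * (potential F + C) + (if w \<in> explored F then 0 else c w * gain F w)"
        by (simp add: algebra_simps split: if_splits)
    qed
    also have "\<dots> = (\<Sum>w\<in>N. c w) * (potential F + C)
        + (\<Sum>w\<in>N. if w \<in> explored F then 0 else c w * gain F w)"
      by (simp add: sum.distrib sum_distrib_right)
    also have "(\<Sum>w\<in>N. if w \<in> explored F then 0 else c w * gain F w)
        = (\<Sum>w\<in>{1..n} - explored F. c w * gain F w)"
      by (rule sum.mono_neutral_cong_right) (auto simp: N_def explored_def)
    also have "\<dots> \<le> 0" unfolding c_def by (rule drift_nonpos[OF F alive(1) tree alive(2,3)])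
    also have "(\<Sum>w\<in>N. c w) = r * real (card (graphs F))"
      using sum_next_neighbour[OF F uV, of "\<lambda>_. 1"] by (simp add: c_def N_def r_def)
    finally have "r * (\<Sum>E\<in>graphs F. ?f E) \<le> r * (real (card (graphs F)) * (potential F + C))"
      by (simp add: mult.assoc)
    then show ?thesis using r by simp
  qed
qed

text \<open>Completing the square leaves \<open>- (1 + 3 * B)\<^sup>2 / 4\<close> as minimum of the
  numerator, where \<open>1 + 3 * B\<close> is at most \<open>7 * \<theta> * m\<close>; 13 rounds up
  49/4.\<close>

lemma h_ge:
  fixes \<theta> :: real
  assumes "B \<le> 2 * \<theta> * card leaves" "1 \<le> \<theta> * card leaves" "0 \<le> B"
  shows "- (13 * \<theta>\<^sup>2 * card leaves) \<le> h a"
proof -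
  define m where "m = real (card leaves)"
  have m: "0 < m" using leaves_ne by (simp add: m_def)
  have "(1 + 3 * B)\<^sup>2 \<le> (7 * \<theta> * m)\<^sup>2"
    using assms by (intro power_mono) (auto simp: m_def)
  moreover have "0 \<le> (2 * real a - (1 + 3 * B))\<^sup>2" by simp
  ultimately have "- (49 * (\<theta> * m)\<^sup>2) \<le> 4 * (real a * (real a - 1) - 3 * B * real a)"
    by (simp add: power2_eq_square algebra_simps)
  moreover have "0 \<le> (\<theta> * m)\<^sup>2" by simp
  ultimately have "- (13 * (\<theta> * m)\<^sup>2) \<le> real a * (real a - 1) - 3 * B * real a"
    by argo
  moreover have "- (13 * \<theta>\<^sup>2 * m) * m = - (13 * (\<theta> * m)\<^sup>2)"
    by (simp add: power2_eq_square)
  ultimately show ?thesis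
    using m by (simp add: h_def le_divide_eq flip: m_def)
qed

text \<open>\<open>\<beta> * W = \<theta> * card leaves\<close> keeps \<open>B\<close> of order
  \<open>\<theta> * card leaves\<close>, so \<open>h_ge\<close> applies. The initial potential
  \<open>sum d S\<close> is at most \<open>\<theta>\<^sup>2 * card leaves\<close>, and dividing the
  total \<open>14 * \<theta>\<^sup>2 * card leaves\<close> by \<open>\<beta>\<close> gives
  \<open>14 * \<theta> * W\<close>.\<close>

lemma average_reach:
  fixes \<theta> :: real
  assumes \<theta>: "0 < \<theta>" "\<theta> \<le> 1" and W: "0 < W" "\<beta> = \<theta> * card leaves / W"
    and leaves: "16 * slack \<le> \<theta>\<^sup>2 * card leaves" "1 \<le> \<theta> * card leaves"
  shows "(\<Sum>E\<in>graphs {}. real (card (reach E - S))) \<le> real (card (graphs {})) * (14 * \<theta> * W)"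
proof -
  define m where "m = real (card leaves)"
  have m: "0 < m" using leaves_ne by (simp add: m_def)
  have X: "real (sum d S) \<le> real slack" by (simp only: of_nat_le_iff slack_def le_add1)
  have "\<theta>\<^sup>2 * m \<le> \<theta> * m" using \<theta> m by (simp add: power2_eq_square)
  then have B: "B \<le> 2 * \<theta> * m"
    using X leaves W unfolding B_def m_def by (simp del: of_nat_sum)
  have "0 \<le> B" unfolding B_def using beta W(1)
    by (intro add_nonneg_nonneg mult_nonneg_nonneg of_nat_0_le_iff) auto
  then have h: "- (13 * \<theta>\<^sup>2 * m) \<le> h a" for a
    using h_ge[of \<theta> a] B leaves by (simp add: m_def)
  have p0: "potential {} = real (sum d S)"
  proof -
    have "S \<inter> leaves = {}" by (auto simp: leaves_def)
    then show ?thesis by (simp add: potential_def explored_def found_def h_def)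
  qed
  have "\<beta> * (\<Sum>E\<in>graphs {}. real (card (reach E - S)))
      \<le> real (card (graphs {})) * (potential {} + 13 * \<theta>\<^sup>2 * m)"
    using reach_bound[of "13 * \<theta>\<^sup>2 * m" "{}"] h
    by (simp add: sum_distrib_left simple_graphs_def explored_def)
  also have "\<dots> \<le> real (card (graphs {})) * (14 * \<theta>\<^sup>2 * m)"
    using X leaves unfolding p0 by (intro mult_left_mono) (simp_all add: m_def del: of_nat_sum)
  also have "\<dots> = \<beta> * (real (card (graphs {})) * (14 * \<theta> * W))"
    using W by (simp add: m_def power2_eq_square)
  finally have "\<beta> * (\<Sum>E\<in>graphs {}. real (card (reach E - S)))
      \<le> \<beta> * (real (card (graphs {})) * (14 * \<theta> * W))" .
  moreover have "0 < \<beta>" using \<theta> m W by (simp add: m_def)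
  ultimately show ?thesis by (simp only: mult_le_cancel_left_pos)
qed

end

section \<open>The choice of \<open>S\<close> and of the constants for a degree sequence\<close>

text \<open>Reduces to \<open>average_reach\<close>: the leaves are shown to make up a constant
  proportion of \<open>M\<close>, and \<open>slack\<close> to be a small multiple of
  \<open>\<theta>\<^sup>2 * M\<close>.\<close>

lemma average_component:
  fixes n :: nat and d :: "nat \<Rightarrow> nat" and \<theta> \<delta> :: real
  defines "M \<equiv> real (\<Sum>i\<in>{i \<in> {1..n}. d i \<noteq> 2}. d i)"
    and "\<G> \<equiv> {E \<in> simple_graphs n. \<forall>i\<in>{1..n}. vertex_degree E i = d i}"
  assumes pos: "\<And>i. i \<in> {1..n} \<Longrightarrow> 1 \<le> d i" and v: "v \<in> {1..n}" and H: "H \<subseteq> {1..n}"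
    and crit: "(\<Sum>i\<in>{1..n} - H. int (d i) * (int (d i) - 2)) \<le> 0"
    and heavy: "real (sum d H) \<le> \<delta> * M"
    and \<theta>: "0 < \<theta>" "\<theta> \<le> 1" and \<delta>: "256 * \<delta> \<le> \<theta>\<^sup>2"
    and T: "3 \<le> T" "256 \<le> \<theta>\<^sup>2 * (real T - 2)" and M: "128 * real (T + T * (T + 1)) \<le> \<theta>\<^sup>2 * M"
  shows "(\<Sum>E\<in>\<G>. real (card (component_of n E v))) \<le> real (card \<G>) * (43 * \<theta> * n)"
proof -
  define V where "V = {1..n}"
  define S where "S = H \<union> {i \<in> V. T \<le> d i} \<union> {v}"
  define g :: "nat \<Rightarrow> real" where "g i = of_bool (3 \<le> d i) * (real (d i) * (real (d i) - 2))" for i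
  define lf :: "nat \<Rightarrow> real" where "lf i = of_bool (d i = 1)" for i
  define nt :: "nat \<Rightarrow> real" where "nt i = of_bool (d i \<noteq> 2) * real (d i)" for i
  define l where "l = (\<Sum>i\<in>V - H. lf i)"
  have fV: "finite V" by (simp add: V_def)
  have HV: "H \<subseteq> V" and fH: "finite H" using H by (auto simp: V_def finite_subset)
  have SV: "S \<subseteq> V" using HV v by (auto simp: S_def V_def)
  have cases: "d i = 1 \<or> d i = 2 \<or> 3 \<le> d i" if "i \<in> V" for i
    using pos that by (force simp: V_def)
  have g0: "0 \<le> g i" "0 \<le> lf i" "0 \<le> nt i" for i by (simp_all add: g_def lf_def nt_def)
  \<comment> \<open>In \<open>crit\<close> only the leaves contribute negatively, each exactly
    \<open>- 1\<close>.\<close>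
  have gl: "(\<Sum>i\<in>V - H. g i) \<le> l"
  proof -
    have "(\<Sum>i\<in>V - H. g i - lf i) = (\<Sum>i\<in>V - H. of_int (int (d i) * (int (d i) - 2)))"
      by (rule sum.cong) (use cases in \<open>force simp: g_def lf_def\<close>)+
    also have "\<dots> = of_int (\<Sum>i\<in>V - H. int (d i) * (int (d i) - 2))" by simp
    also have "\<dots> \<le> 0" using crit unfolding V_def of_int_le_0_iff .
    finally show ?thesis by (simp add: sum_subtractf l_def)
  qed
  have Msum: "M = (\<Sum>i\<in>V. nt i)"
  proof -
    have "M = (\<Sum>i\<in>{i \<in> V. d i \<noteq> 2}. nt i)"
      by (auto simp: M_def V_def nt_def intro: sum.cong)
    also have "\<dots> = (\<Sum>i\<in>V. nt i)"
      by (rule sum.mono_neutral_left) (auto simp: V_def nt_def)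
    finally show ?thesis .
  qed
  have lM: "l \<le> M"
  proof -
    have "l \<le> (\<Sum>i\<in>V - H. nt i)"
      unfolding l_def by (rule sum_mono) (auto simp: lf_def nt_def)
    also have "\<dots> \<le> M"
      unfolding Msum by (rule sum_mono2[OF fV]) (auto simp: g0)
    finally show ?thesis .
  qed
  \<comment> \<open>Outside \<open>H\<close> the degrees other than 2 sum to at most
    \<open>l\<close> plus the excess, hence to at most \<open>2 * l\<close>.\<close>
  have Ml: "M \<le> 2 * l + \<delta> * M"
  proof -
    have "M = (\<Sum>i\<in>V - H. nt i) + (\<Sum>i\<in>H. nt i)"
      unfolding Msum by (rule sum.subset_diff[OF HV fV])
    also have "(\<Sum>i\<in>V - H. nt i) \<le> (\<Sum>i\<in>V - H. lf i + g i)"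
    proof (rule sum_mono)
      fix i assume "i \<in> V - H"
      then consider "d i = 1" | "d i = 2" | "3 \<le> d i" using cases by blast
      then show "nt i \<le> lf i + g i"
      proof cases
        case 3
        then have "real (d i) * 1 \<le> real (d i) * (real (d i) - 2)"
          by (intro mult_left_mono) auto
        then show ?thesis using 3 by (simp add: nt_def lf_def g_def)
      qed (simp_all add: nt_def lf_def g_def)
    qed
    also have "(\<Sum>i\<in>V - H. lf i + g i) \<le> 2 * l"
      using gl by (simp add: sum.distrib l_def)
    also have "(\<Sum>i\<in>H. nt i) \<le> (\<Sum>i\<in>H. real (d i))"
      by (rule sum_mono) (simp add: nt_def)
    also have "\<dots> \<le> \<delta> * M" using heavy by simp
    finally show ?thesis by simp
  qed
  have M0: "0 \<le> M" unfolding M_def by (rule of_nat_0_le_iff)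
  have "\<delta> * M \<le> \<theta>\<^sup>2 / 256 * M" using \<delta> M0 by (intro mult_right_mono) auto
  then have dM: "256 * (\<delta> * M) \<le> \<theta>\<^sup>2 * M" by simp
  have "\<theta>\<^sup>2 \<le> 1" using \<theta> by (simp add: power_le_one)
  then have tM: "\<theta>\<^sup>2 * M \<le> M" using M0 by (simp add: mult_left_le_one_le)
  have "3 * 4 \<le> T * (T + 1)" using T by (intro mult_le_mono) auto
  then have T12: "12 \<le> real (T * (T + 1))" by linarith
  interpret ex: exploration n d S T
  proof
    show "S \<subseteq> {1..n}" using SV by (simp add: V_def)
    show "d i \<le> T" if "i \<in> {1..n}" "i \<notin> S" for i using that by (auto simp: S_def V_def)
  qed (rule pos)
  define m where "m = real (card ex.leaves)"
  have fl: "finite ex.leaves" by (simp add: ex.leaves_def)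
  \<comment> \<open>As \<open>3 \<le> T\<close>, passing from \<open>H\<close> to \<open>S\<close>
    can lose no leaf except \<open>v\<close>.\<close>
  have lm: "l \<le> m + 1"
  proof -
    have "l = real (card ((V - H) \<inter> {i. d i = 1}))"
      using fV by (simp add: l_def lf_def)
    also have "(V - H) \<inter> {i. d i = 1} \<subseteq> insert v ex.leaves"
      unfolding ex.leaves_def using T(1) by (auto simp: S_def V_def)
    then have "card ((V - H) \<inter> {i. d i = 1}) \<le> card (insert v ex.leaves)"
      using fl by (intro card_mono) auto
    also have "\<dots> \<le> card ex.leaves + 1" by (simp add: card_insert_if fl)
    finally show ?thesis by (simp add: m_def)
  qed
  have gVH: "(\<Sum>i\<in>R. g i) \<le> l" if "R \<subseteq> V - H" for R
  proof -
    have "(\<Sum>i\<in>R. g i) \<le> (\<Sum>i\<in>V - H. g i)"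
      by (rule sum_mono2) (use that fV g0 in auto)
    then show ?thesis using gl by simp
  qed
  define R where "R = {i \<in> V - H. T \<le> d i}"
  have fR: "finite R" using fV by (simp add: R_def)
  \<comment> \<open>A vertex of degree at least \<open>T\<close> has excess at least
    \<open>T - 2\<close> times its degree, and the excesses sum to at most
    \<open>l \<le> M\<close>.\<close>
  have Rd: "256 * (\<Sum>i\<in>R. real (d i)) \<le> \<theta>\<^sup>2 * M"
  proof -
    have "(real T - 2) * (\<Sum>i\<in>R. real (d i)) \<le> (\<Sum>i\<in>R. g i)"
      unfolding sum_distrib_left
    proof (rule sum_mono)
      fix i assume "i \<in> R"
      then have "T \<le> d i" by (simp add: R_def)
      then have "(real T - 2) * real (d i) \<le> (real (d i) - 2) * real (d i)"
        by (intro mult_right_mono) auto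
      then show "(real T - 2) * real (d i) \<le> g i"
        using T \<open>T \<le> d i\<close> by (simp add: g_def mult.commute)
    qed
    also have "\<dots> \<le> l" by (rule gVH) (auto simp: R_def)
    also note lM
    finally have "\<theta>\<^sup>2 * ((real T - 2) * (\<Sum>i\<in>R. real (d i))) \<le> \<theta>\<^sup>2 * M"
      by (intro mult_left_mono) auto
    moreover have "256 * (\<Sum>i\<in>R. real (d i)) \<le> \<theta>\<^sup>2 * (real T - 2) * (\<Sum>i\<in>R. real (d i))"
      using T by (intro mult_right_mono sum_nonneg) auto
    ultimately show ?thesis by (simp add: mult.assoc)
  qed
  have Sd: "sum d S \<le> sum d H + sum d R + T"
  proof -
    have "S = H \<union> R \<union> ({v} - (H \<union> R))" by (auto simp: S_def R_def)
    then have "sum d S = sum d (H \<union> R \<union> ({v} - (H \<union> R)))" by simp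
    also have "\<dots> = sum d (H \<union> R) + sum d ({v} - (H \<union> R))"
      by (rule sum.union_disjoint) (use fH fR in auto)
    also have "sum d (H \<union> R) = sum d H + sum d R"
      by (rule sum.union_disjoint) (use fH fR in \<open>auto simp: R_def\<close>)
    also have "sum d ({v} - (H \<union> R)) \<le> T"
    proof (cases "v \<in> H \<union> R")
      case False
      then have "{v} - (H \<union> R) = {v}" "d v \<le> T" using v by (auto simp: R_def V_def)
      then show ?thesis by simp
    qed simp
    finally show ?thesis by simp
  qed
  \<comment> \<open>In units of \<open>\<theta>\<^sup>2 * M\<close>, both \<open>H\<close> and
    \<open>R\<close> cost at most 1/256 and the terms in \<open>T\<close> alone at most 1/128,
    together 1/64.\<close>
  have slack: "64 * real ex.slack \<le> \<theta>\<^sup>2 * M"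
  proof -
    have "real ex.slack \<le> real (sum d H) + real (sum d R) + real (T + T * (T + 1))"
      using Sd unfolding ex.slack_def by (simp only: of_nat_add[symmetric] of_nat_le_iff)
    moreover have "256 * real (sum d R) \<le> \<theta>\<^sup>2 * M" using Rd by simp
    moreover have "64 * s \<le> e" if "s \<le> x + y + z" "256 * y \<le> e" "x \<le> w" "256 * w \<le> e" "128 * z \<le> e"
      for s x y z w e :: real
      using that by linarith
    ultimately show ?thesis using heavy dM M by blast
  qed
  \<comment> \<open>This absolute lower bound on \<open>slack\<close> makes \<open>M\<close> and
    \<open>m\<close> large enough to absorb additive constants such as the 1 in
    \<open>lm\<close>.\<close>
  have "T * (T + 1) \<le> ex.slack" by (simp add: ex.slack_def)
  then have s12: "12 \<le> real ex.slack" using T12 by linarith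
  have mM: "M \<le> 4 * m"
    using Ml dM tM lm slack s12 by linarith
  have "\<theta>\<^sup>2 * M \<le> \<theta>\<^sup>2 * (4 * m)" using mM by (intro mult_left_mono) auto
  then have sm: "16 * real ex.slack \<le> \<theta>\<^sup>2 * m" using slack by linarith
  have m0: "0 \<le> m" by (simp add: m_def)
  have tm: "\<theta>\<^sup>2 * m \<le> \<theta> * m" "\<theta> * m \<le> m"
    using \<theta> m0 by (simp_all add: power2_eq_square mult_left_le_one_le mult_right_mono)
  have Xs: "sum d S \<le> ex.slack" by (simp add: ex.slack_def)
  have m1: "1 \<le> m" "1 \<le> \<theta> * m" using sm s12 tm by linarith+
  have s16: "16 * real ex.slack \<le> m" using sm tm by linarith
  have "3 * (x + real ex.slack) \<le> m" if "x \<le> real ex.slack" for x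
    using that s16 s12 by argo
  then have small: "3 * (real (sum d S) + real ex.slack) \<le> m"
    using of_nat_mono[OF Xs] by blast
  have n0: "0 < n" using v by simp
  have VS: "V - S \<subseteq> V - H" by (auto simp: S_def)
  \<comment> \<open>A degree is at most 2 plus its excess, so the degrees outside \<open>S\<close>
    sum to at most \<open>2 * n + l \<le> 3 * n\<close>, the value of \<open>W\<close>.\<close>
  interpret ex: subcritical_exploration n d S T "3 * real n" "\<theta> * card ex.leaves / (3 * real n)"
  proof
    have "real (\<Sum>i\<in>{i \<in> {1..n} - S. 3 \<le> d i}. d i * (d i - 2)) = (\<Sum>i\<in>{i \<in> {1..n} - S. 3 \<le> d i}. g i)"
      unfolding of_nat_sum by (rule sum.cong) (auto simp: g_def of_nat_diff)
    also have "\<dots> \<le> l" by (rule gVH) (use VS in \<open>auto simp: V_def\<close>)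
    also have "\<dots> \<le> real (card ex.leaves + 1)" using lm by (simp add: m_def)
    finally show "(\<Sum>i\<in>{i \<in> {1..n} - S. 3 \<le> d i}. d i * (d i - 2)) \<le> card ex.leaves + 1"
      by (simp only: of_nat_le_iff)
    have "real (\<Sum>i\<in>{1..n} - S. d i) \<le> (\<Sum>i\<in>V - S. 2 + g i)"
      unfolding of_nat_sum V_def[symmetric]
    proof (rule sum_mono)
      fix i assume "i \<in> V - S"
      then consider "d i = 1" | "d i = 2" | "3 \<le> d i" using cases by blast
      then show "real (d i) \<le> 2 + g i"
      proof cases
        case 3
        then have "1 * (real (d i) - 2) \<le> real (d i) * (real (d i) - 2)"
          by (intro mult_right_mono) auto
        moreover have "g i = real (d i) * (real (d i) - 2)" using 3 by (simp add: g_def)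
        ultimately have "real (d i) - 2 \<le> g i" by (simp only: mult_1_left)
        then show ?thesis by linarith
      qed (simp_all add: g_def)
    qed
    also have "\<dots> = 2 * real (card (V - S)) + (\<Sum>i\<in>V - S. g i)"
      by (simp add: sum.distrib)
    also have "(\<Sum>i\<in>V - S. g i) \<le> l" by (rule gVH[OF VS])
    also have "l \<le> real n"
    proof -
      have "l \<le> (\<Sum>i\<in>V - H. 1)" unfolding l_def by (rule sum_mono) (simp add: lf_def)
      also have "\<dots> = real (card (V - H))" by simp
      also have "\<dots> \<le> real (card V)" using fV by (simp add: card_mono)
      finally show ?thesis by (simp add: V_def)
    qed
    also have "real (card (V - S)) \<le> real (card V)" using fV by (simp add: card_mono)
    finally show "real (\<Sum>i\<in>{1..n} - S. d i) \<le> 3 * real n" by (simp add: V_def)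
    have "real (3 * (sum d S + ex.slack)) \<le> real (card ex.leaves)"
      using small by (simp add: m_def)
    then show "3 * (sum d S + ex.slack) \<le> card ex.leaves" by (simp only: of_nat_le_iff)
    show "1 \<le> card ex.leaves" using m1 by (simp add: m_def)
    show "0 \<le> \<theta> * card ex.leaves / (3 * real n)" using \<theta> by simp
  qed
  have G: "\<G> = ex.graphs {}" by (simp add: assms(2) ex.graphs_def)
  have avg: "(\<Sum>E\<in>\<G>. real (card (ex.reach E - S))) \<le> real (card \<G>) * (42 * \<theta> * n)"
    using ex.average_reach[OF \<theta>] n0 sm m1 unfolding G m_def by (simp add: mult.assoc)
  \<comment> \<open>Degrees are positive, so \<open>card S \<le> sum d S \<le> slack\<close>. This
    adds one \<open>\<theta> * n\<close> to the 42 = 3 * 14 of \<open>avg\<close>.\<close>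
  have "real (card S) \<le> \<theta> * n"
  proof -
    have "(\<Sum>i\<in>S. 1) \<le> (\<Sum>i\<in>S. d i)"
      by (rule sum_mono) (metis pos SV V_def subsetD)
    then have "card S \<le> sum d S" by simp
    then have "real (card S) \<le> real ex.slack" using Xs by (simp only: of_nat_le_iff le_trans)
    moreover have "m \<le> real n"
    proof -
      have "card ex.leaves \<le> card V" by (rule card_mono[OF fV]) (auto simp: ex.leaves_def V_def)
      then show ?thesis by (simp add: m_def V_def)
    qed
    then have "\<theta> * m \<le> \<theta> * n" using \<theta> by (intro mult_left_mono) auto
    ultimately show ?thesis using sm tm s12 by linarith
  qed
  moreover have "card (component_of n E v) \<le> card S + card (ex.reach E - S)" for E
  proof -
    have fin: "finite (ex.reach E)"
      by (rule finite_subset[of _ "{1..n}"]) (auto simp: ex.reach_def component_of_def)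
    have "v \<in> S" by (simp add: S_def)
    then have "component_of n E v \<subseteq> S \<union> (ex.reach E - S)"
      by (auto simp: ex.reach_def)
    then have "card (component_of n E v) \<le> card (S \<union> (ex.reach E - S))"
      using fin ex.finite_S by (intro card_mono) auto
    also have "\<dots> \<le> card S + card (ex.reach E - S)" by (rule card_Un_le)
    finally show ?thesis .
  qed
  ultimately have "real (card (component_of n E v)) \<le> \<theta> * n + real (card (ex.reach E - S))" for E
    by (smt (verit) of_nat_add of_nat_mono)
  then have "(\<Sum>E\<in>\<G>. real (card (component_of n E v)))
      \<le> (\<Sum>E\<in>\<G>. \<theta> * n + real (card (ex.reach E - S)))"
    by (intro sum_mono) auto
  also have "\<dots> \<le> real (card \<G>) * (43 * \<theta> * n)"
    using avg by (simp add: sum.distrib algebra_simps)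
  finally show ?thesis .
qed

section \<open>Large components, heavy vertices and Markov's inequality\<close>

lemma component_of_eq:
  assumes "w \<in> component_of n E u"
  shows "component_of n E w = component_of n E u"
proof -
  have "sym (adj_rel E)" by (auto simp: sym_def adj_rel_def insert_commute)
  then have "(w, u) \<in> (adj_rel E)\<^sup>*" "(u, w) \<in> (adj_rel E)\<^sup>*"
    using assms sym_rtrancl[of "adj_rel E"] by (auto simp: component_of_def sym_def)
  then show ?thesis by (auto simp: component_of_def dest: rtrancl_trans)
qed

text \<open>\<open>C\<close> is the component of each of its own \<open>card C\<close>
  vertices.\<close>

lemma square_card_component_le:
  assumes "C \<in> graph_components n E"
  shows "(card C)\<^sup>2 \<le> (\<Sum>v\<in>{1..n}. card (component_of n E v))"
proof -
  obtain u where C: "C = component_of n E u" using assms by (auto simp: graph_components_def)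
  have "(card C)\<^sup>2 = (\<Sum>v\<in>C. card C)" by (simp add: power2_eq_square)
  also have "\<dots> = (\<Sum>v\<in>C. card (component_of n E v))"
    by (rule sum.cong) (auto simp: C component_of_eq)
  also have "\<dots> \<le> (\<Sum>v\<in>{1..n}. card (component_of n E v))"
    by (rule sum_mono2) (auto simp: C component_of_def)
  finally show ?thesis .
qed

text \<open>\<open>j_idx\<close> and \<open>R_sum\<close> refer to positions in the sorted list; a
  sorting permutation carries the positions from \<open>j_idx D\<close> on to vertices, which form
  \<open>H\<close>.\<close>

lemma heavy_set:
  assumes D: "D \<noteq> []"
  obtains H where "H \<subseteq> {1..length D}" "sum (entry D) H = R_sum D"
    "(\<Sum>i\<in>{1..length D} - H. int (entry D i) * (int (entry D i) - 2)) \<le> 0"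
proof -
  define n where "n = length D"
  define P where "P j \<longleftrightarrow> 0 < (\<Sum>i=1..j. int (entry (sort D) i) * (int (entry (sort D) i) - 2))" for j
  define J where "J = {j \<in> {1..n}. P j} \<union> {n}"
  have j_def: "j_idx D = Min J" by (simp add: j_idx_def J_def P_def n_def)
  have n: "1 \<le> n" using D by (cases D) (auto simp: n_def)
  have J: "finite J" "J \<noteq> {}" "J \<subseteq> {1..n}" using n by (auto simp: J_def)
  have j: "j_idx D \<in> {1..n}" using Min_in[OF J(1,2)] J(3) by (auto simp: j_def)
  \<comment> \<open>By minimality of \<open>j_idx D\<close>, also when it is the default
    \<open>n\<close>; for \<open>j_idx D = 1\<close> the sum is empty.\<close>
  have "\<not> P (j_idx D - 1)"
  proof
    assume *: "P (j_idx D - 1)"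
    then have "j_idx D - 1 \<noteq> 0" by (auto simp: P_def)
    then have "j_idx D - 1 \<in> J" using * j by (auto simp: J_def)
    then have "j_idx D \<le> j_idx D - 1" using J by (simp add: j_def)
    then show False using j by auto
  qed
  then have small: "(\<Sum>i=1..j_idx D - 1. int (entry (sort D) i) * (int (entry (sort D) i) - 2)) \<le> 0"
    by (simp add: P_def)
  obtain p where p: "p permutes {..<n}" "permute_list p D = sort D"
    using mset_eq_permutation[of "sort D" D] by (auto simp: n_def)
  \<comment> \<open>List positions start at 0, vertices at 1.\<close>
  define q where "q i = Suc (p (i - 1))" for i
  have q: "q i \<in> {1..n} \<and> entry (sort D) i = entry D (q i)" if "i \<in> {1..n}" for i
  proof -
    have i: "i - 1 < n" using that by auto
    then have "p (i - 1) < n" using permutes_in_image[OF p(1), of "i - 1"] by simp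
    moreover have "sort D ! (i - 1) = D ! p (i - 1)"
      using permute_list_nth[of p D "i - 1"] p i by (simp add: n_def)
    ultimately show ?thesis by (simp add: q_def entry_def)
  qed
  have inj: "inj_on q {1..n}"
  proof (rule inj_onI)
    fix x y assume xy: "x \<in> {1..n}" "y \<in> {1..n}" "q x = q y"
    then have "x - 1 = y - 1" using permutes_inj[OF p(1)] by (simp add: q_def inj_eq)
    then show "x = y" using xy by auto
  qed
  have "q ` {1..n} \<subseteq> {1..n}" using q by blast
  then have qV: "q ` {1..n} = {1..n}"
    by (rule endo_inj_surj[OF finite_atLeastAtMost _ inj])
  define H where "H = q ` {j_idx D..n}"
  have H: "H \<subseteq> {1..n}"
    unfolding H_def by (rule subset_trans[OF image_mono[of _ "{1..n}"]]) (use j qV in auto)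
  have "{1..n} - H = q ` {1..n} - q ` {j_idx D..n}" by (simp only: H_def qV)
  also have "\<dots> = q ` ({1..n} - {j_idx D..n})"
    by (rule inj_on_image_set_diff[OF inj, symmetric]) (use j in auto)
  also have "{1..n} - {j_idx D..n} = {1..j_idx D - 1}" using j by auto
  finally have VH: "{1..n} - H = q ` {1..j_idx D - 1}" .
  have sum_q: "(\<Sum>i\<in>q ` I. f (entry D i)) = (\<Sum>i\<in>I. f (entry (sort D) i))"
    if "I \<subseteq> {1..n}" for I and f :: "nat \<Rightarrow> 'b::comm_monoid_add"
  proof -
    have "(\<Sum>i\<in>q ` I. f (entry D i)) = (\<Sum>i\<in>I. f (entry D (q i)))"
      using inj_on_subset[OF inj that] by (simp add: sum.reindex)
    also have "\<dots> = (\<Sum>i\<in>I. f (entry (sort D) i))"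
      by (rule sum.cong[OF refl]) (metis q subsetD that)
    finally show ?thesis .
  qed
  show thesis
  proof (rule that)
    show "H \<subseteq> {1..length D}" using H by (simp add: n_def)
    show "sum (entry D) H = R_sum D"
      using sum_q[of "{j_idx D..n}" "\<lambda>x. x"] j by (simp add: H_def R_sum_def n_def)
    show "(\<Sum>i\<in>{1..length D} - H. int (entry D i) * (int (entry D i) - 2)) \<le> 0"
    proof -
      have "{1..j_idx D - 1} \<subseteq> {1..n}" using j by auto
      from sum_q[OF this, of "\<lambda>x. int x * (int x - 2)"] small show ?thesis
        unfolding VH[unfolded n_def] by (simp only:)
    qed
  qed
qed

text \<open>Markov's inequality for the sum of all component orders over the vertices: its average
  over the realizations is at most \<open>43 * \<theta> * n\<^sup>2\<close>, while a large component
  makes it at least \<open>(\<gamma> * n)\<^sup>2\<close>.\<close>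

lemma prob_giant_le:
  fixes \<theta> \<delta> \<gamma> :: real
  assumes D: "degree_sequence D" "feasible D" and R: "real (R_sum D) \<le> \<delta> * real (M_sum D)"
    and \<theta>: "0 < \<theta>" "\<theta> \<le> 1" and \<delta>: "256 * \<delta> \<le> \<theta>\<^sup>2"
    and T: "3 \<le> T" "256 \<le> \<theta>\<^sup>2 * (real T - 2)"
    and M: "128 * real (T + T * (T + 1)) \<le> \<theta>\<^sup>2 * M_sum D" and \<gamma>: "0 < \<gamma>"
  shows "measure_pmf.prob (random_graph D)
      {E. \<exists>C\<in>graph_components (length D) E. \<gamma> * length D \<le> card C} \<le> 43 * \<theta> / \<gamma>\<^sup>2"
proof -
  define n where "n = length D"
  define \<G> where "\<G> = realizations D"
  define c where "c E = (\<Sum>v\<in>{1..n}. real (card (component_of n E v)))" for E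
  define Q where "Q = {E. \<exists>C\<in>graph_components n E. \<gamma> * n \<le> card C}"
  have fin: "finite \<G>" "\<G> \<noteq> {}" using D by (simp_all add: \<G>_def finite_realizations feasible_def)
  then have G0: "0 < card \<G>" by (simp add: card_gt_0_iff)
  have D0: "D \<noteq> []" and pos: "\<And>i. i \<in> {1..n} \<Longrightarrow> 1 \<le> entry D i"
    using D by (auto simp: degree_sequence_def n_def Suc_le_eq)
  have n0: "0 < n" using D0 by (simp add: n_def)
  obtain H where H: "H \<subseteq> {1..n}" "sum (entry D) H = R_sum D"
    "(\<Sum>i\<in>{1..n} - H. int (entry D i) * (int (entry D i) - 2)) \<le> 0"
    using heavy_set[OF D0] by (auto simp: n_def)
  have avg: "(\<Sum>E\<in>\<G>. real (card (component_of n E v))) \<le> real (card \<G>) * (43 * \<theta> * n)"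
    if "v \<in> {1..n}" for v
    using average_component[OF pos that H(1,3), of \<delta> \<theta> T] R \<theta> \<delta> T M H(2)
    by (simp only: \<G>_def realizations_def n_def M_sum_def)
  have "(\<gamma> * n)\<^sup>2 * real (card (\<G> \<inter> Q)) = (\<Sum>E\<in>\<G> \<inter> Q. (\<gamma> * n)\<^sup>2)" by simp
  also have "\<dots> \<le> (\<Sum>E\<in>\<G> \<inter> Q. c E)"
  proof (rule sum_mono)
    fix E assume "E \<in> \<G> \<inter> Q"
    then obtain C where C: "C \<in> graph_components n E" "\<gamma> * n \<le> card C" by (auto simp: Q_def)
    have "(\<gamma> * n)\<^sup>2 \<le> (real (card C))\<^sup>2" using C \<gamma> by (intro power_mono) auto
    also have "\<dots> \<le> real (\<Sum>v\<in>{1..n}. card (component_of n E v))"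
      using of_nat_mono[OF square_card_component_le[OF C(1)], where ?'a = real] by simp
    finally show "(\<gamma> * n)\<^sup>2 \<le> c E" by (simp add: c_def)
  qed
  also have "\<dots> \<le> (\<Sum>E\<in>\<G>. c E)"
    by (rule sum_mono2) (use fin in \<open>auto simp: c_def sum_nonneg\<close>)
  also have "\<dots> = (\<Sum>v\<in>{1..n}. \<Sum>E\<in>\<G>. real (card (component_of n E v)))"
    unfolding c_def by (rule sum.swap)
  also have "\<dots> \<le> (\<Sum>v\<in>{1..n}. real (card \<G>) * (43 * \<theta> * n))"
    by (rule sum_mono) (rule avg)
  also have "\<dots> = real n ^ 2 * (real (card \<G>) * (43 * \<theta>))"
    by (simp add: power2_eq_square)
  finally have "real n ^ 2 * (\<gamma>\<^sup>2 * real (card (\<G> \<inter> Q))) \<le> real n ^ 2 * (real (card \<G>) * (43 * \<theta>))"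
    by (simp add: power_mult_distrib mult_ac)
  then have "\<gamma>\<^sup>2 * real (card (\<G> \<inter> Q)) \<le> real (card \<G>) * (43 * \<theta>)"
    using n0 by (simp only: mult_le_cancel_left_pos zero_less_power of_nat_0_less_iff)
  then have "real (card (\<G> \<inter> Q)) / real (card \<G>) \<le> 43 * \<theta> / \<gamma>\<^sup>2"
    using G0 \<gamma> by (simp add: divide_simps mult_ac)
  moreover have "measure_pmf.prob (random_graph D) Q = real (card (\<G> \<inter> Q)) / real (card \<G>)"
    unfolding random_graph_def \<G>_def[symmetric] by (rule measure_pmf_of_set) (use fin in auto)
  ultimately show ?thesis by (simp add: Q_def n_def)
qed

theorem theorem1:
  fixes lam :: "nat \<Rightarrow> nat" and \<delta> :: "nat \<Rightarrow> real" and \<gamma> :: real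
  assumes "filterlim lam at_top sequentially"
    and "\<And>n. \<delta> n \<ge> 0"
    and "\<delta> \<longlonglongrightarrow> 0"
    and "\<gamma> > 0"
  shows "\<exists>\<eta> :: nat \<Rightarrow> real. \<eta> \<longlonglongrightarrow> 0 \<and>
    (\<forall>n D. degree_sequence D \<longrightarrow> length D = n \<longrightarrow> feasible D \<longrightarrow> well_behaved lam D \<longrightarrow>
       real (R_sum D) \<le> \<delta> n * real (M_sum D) \<longrightarrow>
       measure_pmf.prob (random_graph D)
         {E. \<exists>C\<in>graph_components n E. real (card C) \<ge> \<gamma> * real n} \<le> \<eta> n)"
proof -
  define p where "p D = measure_pmf.prob (random_graph D)
      {E. \<exists>C\<in>graph_components (length D) E. \<gamma> * length D \<le> card C}" for D
  define A where "A n = {D. degree_sequence D \<and> length D = n \<and> feasible D \<and> well_behaved lam D \<and>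
      real (R_sum D) \<le> \<delta> n * real (M_sum D)}" for n
  \<comment> \<open>The worst probability over all admissible sequences of length \<open>n\<close>;
    the inserted 0 covers lengths that admit none.\<close>
  define \<eta> where "\<eta> n = Sup (insert 0 (p ` A n))" for n
  have bdd: "bdd_above (insert 0 (p ` A n))" for n
    by (rule bdd_aboveI[of _ 1]) (auto simp: p_def)
  have \<eta>0: "0 \<le> \<eta> n" for n unfolding \<eta>_def by (rule cSup_upper[OF _ bdd]) simp
  have "\<eta> \<longlonglongrightarrow> 0"
  proof (rule LIMSEQ_I)
    fix \<epsilon> :: real assume \<epsilon>: "0 < \<epsilon>"
    \<comment> \<open>Makes \<open>43 * \<theta> / \<gamma>\<^sup>2\<close> at most
      \<open>\<epsilon> / 2\<close>. Then \<open>T\<close> is chosen from \<open>\<theta>\<close>,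
      \<open>M0\<close> from both, and \<open>N\<close> from the limits of \<open>lam\<close> and
      \<open>\<delta>\<close>.\<close>
    define \<theta> where "\<theta> = min 1 (\<epsilon> * \<gamma>\<^sup>2 / 86)"
    have \<theta>: "0 < \<theta>" "\<theta> \<le> 1" "43 * \<theta> / \<gamma>\<^sup>2 \<le> \<epsilon> / 2"
      using \<epsilon> assms(4) by (auto simp: \<theta>_def field_simps min_def)
    obtain T0 :: nat where "256 / \<theta>\<^sup>2 \<le> T0" using real_arch_simple by blast
    then have "256 \<le> \<theta>\<^sup>2 * real T0" using \<theta> by (simp add: field_simps)
    then have T: "256 \<le> \<theta>\<^sup>2 * (real (T0 + 3) - 2)" "3 \<le> T0 + 3"
      by (simp_all add: algebra_simps add_increasing)
    define T where "T = T0 + 3"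
    obtain M0 :: nat where "128 * real (T + T * (T + 1)) / \<theta>\<^sup>2 \<le> M0" using real_arch_simple by blast
    then have M0: "128 * real (T + T * (T + 1)) \<le> \<theta>\<^sup>2 * M0"
      using \<theta> by (simp add: field_simps)
    have "\<forall>\<^sub>F n in sequentially. M0 \<le> lam n"
      using assms(1) by (simp add: filterlim_at_top)
    moreover have "\<forall>\<^sub>F n in sequentially. \<delta> n < \<theta>\<^sup>2 / 256"
      by (rule order_tendstoD[OF assms(3)]) (use \<theta> in simp)
    ultimately have "\<forall>\<^sub>F n in sequentially. M0 \<le> lam n \<and> \<delta> n < \<theta>\<^sup>2 / 256"
      by (rule eventually_conj)
    then obtain N where N: "\<And>n. N \<le> n \<Longrightarrow> M0 \<le> lam n \<and> \<delta> n < \<theta>\<^sup>2 / 256"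
      by (auto simp: eventually_sequentially)
    have "norm (\<eta> n - 0) < \<epsilon>" if n: "N \<le> n" for n
    proof -
      have "p D \<le> \<epsilon> / 2" if D: "D \<in> A n" for D
      proof -
        have "M0 \<le> M_sum D" using D N[OF n] by (auto simp: A_def well_behaved_def)
        then have "\<theta>\<^sup>2 * real M0 \<le> \<theta>\<^sup>2 * real (M_sum D)" by (intro mult_left_mono) auto
        then have M: "128 * real (T + T * (T + 1)) \<le> \<theta>\<^sup>2 * M_sum D" using M0 by linarith
        have "p D \<le> 43 * \<theta> / \<gamma>\<^sup>2"
          unfolding p_def using D N[OF n]
          by (intro prob_giant_le[OF _ _ _ \<theta>(1,2) _ T(2,1)[folded T_def] M assms(4)])
            (auto simp: A_def)
        then show ?thesis using \<theta> by simp
      qed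
      then have "\<eta> n \<le> \<epsilon> / 2"
        unfolding \<eta>_def using \<epsilon> by (intro cSup_least) auto
      then show ?thesis using \<eta>0[of n] \<epsilon> by simp
    qed
    then show "\<exists>N. \<forall>n\<ge>N. norm (\<eta> n - 0) < \<epsilon>" by blast
  qed
  moreover have "p D \<le> \<eta> n" if "D \<in> A n" for D n
    unfolding \<eta>_def by (rule cSup_upper[OF _ bdd]) (use that in simp)
  then have "\<forall>n D. degree_sequence D \<longrightarrow> length D = n \<longrightarrow> feasible D \<longrightarrow> well_behaved lam D \<longrightarrow>
       real (R_sum D) \<le> \<delta> n * real (M_sum D) \<longrightarrow>
       measure_pmf.prob (random_graph D)
         {E. \<exists>C\<in>graph_components n E. real (card C) \<ge> \<gamma> * real n} \<le> \<eta> n"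
    by (auto simp: A_def p_def)
  ultimately show ?thesis by blast
qed

end
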